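(* Let $G$ and $H$ be finite simple graphs which are homeomorphic, i.e. $G$ and $H$ can be equipped with graph topologies such that the resulting topological graphs $(G,\mathcal{B},\mathcal{O})$ and $(H,\mathcal{C},\mathcal{P})$ are homeomorphic. Then $G$ and $H$ have the same cohomology: $H^k(G)\cong H^k(H)$ as vector spaces for every $k\ge 0$.
   Context: All graphs are finite and simple. For a vertex $x$ of a graph $G=(V,E)$, the unit sphere $S(x)$ is the subgraph of $G$ generated (induced) by all vertices adjacent to $x$. The intersection of two subgraphs is the subgraph formed by their common vertices and common edges; a subgraph is also regarded as the set of its vertices when speaking of topologies on $V$. Dimension: $\dim(\emptyset)=-1$ and inductively $\dim(G)=\frac{1}{|V|}\sum_{x\in V}(1+\dim(S(x)))$. Homotopy: the one-point graph $K_1$ is contractible. A homotopy extension of a graph selects a contractible (induced) subgraph $H$ and adds a new vertex $z$ connected exactly to all vertices of $H$ (so $S(z)=H$). The reverse step removes a vertex $z$ with contractible unit sphere $S(z)$, together with all edges at $z$. Two graphs are homotopic if one can be obtained from the other by a finite sequence of such steps; a graph is contractible if it is homotopic to $K_1$. (This is an inductive definition.) Graph topology: two subgraphs $A,B$ satisfy the dimension assumption if $\dim(A\cap B)\ge \min(\dim(A),\dim(B))$, where the dimensions are those of these subgraphs as graphs themselves. A topology $\mathcal{O}$ on $V$ is a graph topology on $G=(V,E)$ if it has a sub-base $\mathcal{B}$ consisting of contractible subgraphs of $G$ such that (i) the intersection of any two elements of $\mathcal{B}$ satisfying the dimension assumption is contractible; (ii) every edge of $G$ is contained in some $B\in\mathcal{B}$;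 (iii) the nerve graph $\mathcal{G}=(\mathcal{B},\mathcal{E})$, whose vertices are the elements of $\mathcal{B}$ and whose edges are the pairs of distinct $A,B\in\mathcal{B}$ satisfying the dimension assumption, is homotopic to $G$. A graph with such a topology, written $(G,\mathcal{B},\mathcal{O})$, is a topological graph. Homeomorphism: given topological graphs $(G,\mathcal{B},\mathcal{O})$ and $(H,\mathcal{C},\mathcal{P})$ with nerve graphs $\mathcal{G},\mathcal{H}$, a map $\phi:\mathcal{O}\to\mathcal{P}$ is continuous if it induces a graph homomorphism $\mathcal{G}\to\mathcal{H}$ (it maps each $A\in\mathcal{B}$ to an element $\phi(A)\in\mathcal{C}$, edges of the nerve going to edges) such that $\dim(\phi(A))\le\dim(A)$ for every $A\in\mathcal{B}$. If $\phi$ has an inverse which is also continuous, $\phi$ is a graph homeomorphism and the topological graphs are homeomorphic. Graph cohomology: $\mathcal{G}_k$ denotes the set of $K_{k+1}$ subgraphs (cliques) of $G$, and $\Omega_k$ the real vector space, of dimension $v_k=|\mathcal{G}_k|$, of alternating functions $f(x_0,\dots,x_k)$ on ordered $(k+1)$-cliques (i.e. $f$ changes by the sign of the permutation when the vertices are permuted). The exterior derivative $d_k:\Omega_k\to\Omega_{k+1}$ is $d_kf(x_0,\dots,x_{k+1})=\sum_{j=0}^{k+1}(-1)^j f(x_0,\dots,\hat{x}_j,\dots,x_{k+1})$, and $H^k(G)=\ker(d_k)/\operatorname{im}(d_{k-1})$ (with $d_{-1}=0$). *)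

theory Defs
  imports "HOL-Analysis.Analysis"
begin

datatype 'a graph = Graph (verts: "'a set") (edges: "'a set set")

definition simple_graph :: "'a graph \<Rightarrow> bool" where
  "simple_graph G \<longleftrightarrow> finite (verts G) \<and> (\<forall>e\<in>edges G. e \<subseteq> verts G \<and> card e = 2)"

definition subgraph :: "'a graph \<Rightarrow> 'a graph \<Rightarrow> bool" where
  "subgraph A G \<longleftrightarrow> simple_graph A \<and> verts A \<subseteq> verts G \<and> edges A \<subseteq> edges G"

definition induced :: "'a graph \<Rightarrow> 'a set \<Rightarrow> 'a graph" where
  "induced G S = Graph S {e \<in> edges G. e \<subseteq> S}"

definition graph_inter :: "'a graph \<Rightarrow> 'a graph \<Rightarrow> 'a graph" where
  "graph_inter A B = Graph (verts A \<inter> verts B) (edges A \<inter> edges B)"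

definition graph_iso :: "'a graph \<Rightarrow> 'b graph \<Rightarrow> bool" where
  "graph_iso G H \<longleftrightarrow>
     (\<exists>f. bij_betw f (verts G) (verts H) \<and> edges H = (\<lambda>e. f ` e) ` edges G)"

definition graph_hom :: "('a \<Rightarrow> 'b) \<Rightarrow> 'a graph \<Rightarrow> 'b graph \<Rightarrow> bool" where
  "graph_hom f G H \<longleftrightarrow>
     f ` verts G \<subseteq> verts H \<and> (\<forall>x y. {x, y} \<in> edges G \<longrightarrow> {f x, f y} \<in> edges H)"

(* The condition y \<noteq> x is automatic in a simple graph; it makes the recursion defining
   the dimension terminate without assumptions on G. *)
definition unit_sphere :: "'a graph \<Rightarrow> 'a \<Rightarrow> 'a graph" where
  "unit_sphere G x = induced G {y \<in> verts G. y \<noteq> x \<and> {x, y} \<in> edges G}"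

(* The value on graphs with infinitely many vertices is irrelevant. *)
function gdim :: "'a graph \<Rightarrow> real" where
  "gdim G = (if finite (verts G) \<and> verts G \<noteq> {}
             then (\<Sum>x\<in>verts G. 1 + gdim (unit_sphere G x)) / real (card (verts G))
             else -1)"
  by auto
termination
proof (relation "Wellfounded.measure (\<lambda>G. card (verts G))")
  fix G :: "'a graph" and x
  assume "finite (verts G) \<and> verts G \<noteq> {}" "x \<in> verts G"
  then have "card {y \<in> verts G. y \<noteq> x \<and> {x, y} \<in> edges G} < card (verts G)"
    by (intro psubset_card_mono) auto
  then show "(unit_sphere G x, G) \<in> Wellfounded.measure (\<lambda>G. card (verts G))"
    by (simp add: unit_sphere_def induced_def)
qed simp

declare gdim.simps [simp del]

definition add_vertex :: "'a graph \<Rightarrow> 'a set \<Rightarrow> 'a \<Rightarrow> 'a graph" where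
  "add_vertex G S z = Graph (insert z (verts G)) (edges G \<union> (\<lambda>y. {z, y}) ` S)"

definition remove_vertex :: "'a graph \<Rightarrow> 'a \<Rightarrow> 'a graph" where
  "remove_vertex G z = induced G (verts G - {z})"

definition one_point :: "'a \<Rightarrow> 'a graph" where
  "one_point v = Graph {v} {}"

(* Homotopy steps are carried out on graphs with vertices in nat, so that a new vertex is
   always available; renaming vertices is a step as well. Contractibility of the subgraphs
   involved in a step is homotopy to a one-point graph. *)
inductive nat_homotopic :: "nat graph \<Rightarrow> nat graph \<Rightarrow> bool" where
  start: "simple_graph G \<Longrightarrow> nat_homotopic G G"
| rename: "nat_homotopic G H \<Longrightarrow> graph_iso H K \<Longrightarrow> nat_homotopic G K"
| extension: "nat_homotopic G H \<Longrightarrow> S \<subseteq> verts H \<Longrightarrow> z \<notin> verts H \<Longrightarrow>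
    nat_homotopic (induced H S) (one_point 0) \<Longrightarrow> nat_homotopic G (add_vertex H S z)"
| reduction: "nat_homotopic G H \<Longrightarrow> z \<in> verts H \<Longrightarrow>
    nat_homotopic (unit_sphere H z) (one_point 0) \<Longrightarrow> nat_homotopic G (remove_vertex H z)"

definition homotopic_graphs :: "'a graph \<Rightarrow> 'b graph \<Rightarrow> bool" where
  "homotopic_graphs G H \<longleftrightarrow>
     (\<exists>G' H'. graph_iso G G' \<and> graph_iso H H' \<and> nat_homotopic G' H')"

definition contractible_graph :: "'a graph \<Rightarrow> bool" where
  "contractible_graph G \<longleftrightarrow> homotopic_graphs G (one_point ())"

definition dim_assumption :: "'a graph \<Rightarrow> 'a graph \<Rightarrow> bool" where
  "dim_assumption A B \<longleftrightarrow> gdim (graph_inter A B) \<ge> min (gdim A) (gdim B)"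

definition nerve :: "'a graph set \<Rightarrow> 'a graph graph" where
  "nerve \<B> = Graph \<B> {{A, B} | A B. A \<in> \<B> \<and> B \<in> \<B> \<and> A \<noteq> B \<and> dim_assumption A B}"

(* relative_to makes the empty intersection the whole vertex set, so a sub-base need not
   cover the vertex set. *)
definition subbase_of :: "'a set set \<Rightarrow> 'a set \<Rightarrow> 'a topology \<Rightarrow> bool" where
  "subbase_of \<S> V T \<longleftrightarrow>
     T = topology (arbitrary union_of (finite intersection_of (\<lambda>U. U \<in> \<S>) relative_to V))"

definition topological_graph :: "'a graph \<Rightarrow> 'a graph set \<Rightarrow> 'a topology \<Rightarrow> bool" where
  "topological_graph G \<B> T \<longleftrightarrow>
     simple_graph G \<and>
     (\<forall>A\<in>\<B>. subgraph A G \<and> contractible_graph A) \<and>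
     subbase_of (verts ` \<B>) (verts G) T \<and>
     (\<forall>A\<in>\<B>. \<forall>B\<in>\<B>. dim_assumption A B \<longrightarrow> contractible_graph (graph_inter A B)) \<and>
     (\<forall>e\<in>edges G. \<exists>B\<in>\<B>. e \<in> edges B) \<and>
     homotopic_graphs (nerve \<B>) G"

(* Elements of a sub-base are subgraphs, while open sets are sets of vertices, and distinct
   subgraphs may have the same vertices. A map \<phi> of open sets therefore comes with the map
   \<psi> of sub-base elements that it induces. *)
definition graph_continuous ::
  "'a graph set \<Rightarrow> 'a topology \<Rightarrow> 'b graph set \<Rightarrow> 'b topology \<Rightarrow>
   ('a set \<Rightarrow> 'b set) \<Rightarrow> ('a graph \<Rightarrow> 'b graph) \<Rightarrow> bool" where
  "graph_continuous \<B> T \<C> P \<phi> \<psi> \<longleftrightarrow>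
     (\<forall>U. openin T U \<longrightarrow> openin P (\<phi> U)) \<and>
     (\<forall>A\<in>\<B>. verts (\<psi> A) = \<phi> (verts A)) \<and>
     graph_hom \<psi> (nerve \<B>) (nerve \<C>) \<and>
     (\<forall>A\<in>\<B>. gdim (\<psi> A) \<le> gdim A)"

definition graph_homeomorphism ::
  "'a graph set \<Rightarrow> 'a topology \<Rightarrow> 'b graph set \<Rightarrow> 'b topology \<Rightarrow>
   ('a set \<Rightarrow> 'b set) \<Rightarrow> ('a graph \<Rightarrow> 'b graph) \<Rightarrow> bool" where
  "graph_homeomorphism \<B> T \<C> P \<phi> \<psi> \<longleftrightarrow>
     graph_continuous \<B> T \<C> P \<phi> \<psi> \<and>
     (\<exists>\<phi>' \<psi>'. graph_continuous \<C> P \<B> T \<phi>' \<psi>' \<and>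
        (\<forall>U. openin T U \<longrightarrow> \<phi>' (\<phi> U) = U) \<and> (\<forall>W. openin P W \<longrightarrow> \<phi> (\<phi>' W) = W) \<and>
        (\<forall>A\<in>\<B>. \<psi>' (\<psi> A) = A) \<and> (\<forall>C\<in>\<C>. \<psi> (\<psi>' C) = C))"

definition homeomorphic_graphs :: "'a graph \<Rightarrow> 'b graph \<Rightarrow> bool" where
  "homeomorphic_graphs G H \<longleftrightarrow>
     (\<exists>\<B> T \<C> P \<phi> \<psi>. topological_graph G \<B> T \<and> topological_graph H \<C> P \<and>
        graph_homeomorphism \<B> T \<C> P \<phi> \<psi>)"

(* Vertex sequences (x_0, ..., x_k) of the subgraphs K_{k+1}. *)
definition ordered_cliques :: "'a graph \<Rightarrow> nat \<Rightarrow> 'a list set" where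
  "ordered_cliques G k =
     {xs. length xs = Suc k \<and> distinct xs \<and> set xs \<subseteq> verts G \<and>
          (\<forall>x\<in>set xs. \<forall>y\<in>set xs. x \<noteq> y \<longrightarrow> {x, y} \<in> edges G)}"

(* Forms are extended by 0 to lists that are not ordered cliques. *)
definition forms :: "'a graph \<Rightarrow> nat \<Rightarrow> ('a list \<Rightarrow> real) set" where
  "forms G k =
     {f. (\<forall>xs. xs \<notin> ordered_cliques G k \<longrightarrow> f xs = 0) \<and>
         (\<forall>xs\<in>ordered_cliques G k. \<forall>p. p permutes {..k} \<longrightarrow>
            f (permute_list p xs) = of_int (sign p) * f xs)}"

definition ext_deriv :: "'a graph \<Rightarrow> nat \<Rightarrow> ('a list \<Rightarrow> real) \<Rightarrow> 'a list \<Rightarrow> real" where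
  "ext_deriv G k f xs =
     (if xs \<in> ordered_cliques G (Suc k)
      then (\<Sum>j\<le>Suc k. (-1) ^ j * f (take j xs @ drop (Suc j) xs)) else 0)"

definition cocycles :: "'a graph \<Rightarrow> nat \<Rightarrow> ('a list \<Rightarrow> real) set" where
  "cocycles G k = {f \<in> forms G k. ext_deriv G k f = (\<lambda>xs. 0)}"

definition coboundaries :: "'a graph \<Rightarrow> nat \<Rightarrow> ('a list \<Rightarrow> real) set" where
  "coboundaries G k =
     (case k of 0 \<Rightarrow> {\<lambda>xs. 0} | Suc m \<Rightarrow> ext_deriv G m ` forms G m)"

definition cohomology :: "'a graph \<Rightarrow> nat \<Rightarrow> ('a list \<Rightarrow> real) set set" where
  "cohomology G k =
     cocycles G k //
       {(f, g). f \<in> cocycles G k \<and> g \<in> cocycles G k \<and> (\<lambda>xs. f xs - g xs) \<in> coboundaries G k}"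

definition class_add ::
  "('a list \<Rightarrow> real) set \<Rightarrow> ('a list \<Rightarrow> real) set \<Rightarrow> ('a list \<Rightarrow> real) set" where
  "class_add X Y = {\<lambda>xs. f xs + g xs | f g. f \<in> X \<and> g \<in> Y}"

(* Adding the coboundaries makes c = 0 give the zero class rather than the single form 0. *)
definition class_scale ::
  "'a graph \<Rightarrow> nat \<Rightarrow> real \<Rightarrow> ('a list \<Rightarrow> real) set \<Rightarrow> ('a list \<Rightarrow> real) set" where
  "class_scale G k c X = {\<lambda>xs. c * f xs + b xs | f b. f \<in> X \<and> b \<in> coboundaries G k}"

definition cohomology_isomorphic :: "nat \<Rightarrow> 'a graph \<Rightarrow> 'b graph \<Rightarrow> bool" where
  "cohomology_isomorphic k G H \<longleftrightarrow>
     (\<exists>F. bij_betw F (cohomology G k) (cohomology H k) \<and>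
        (\<forall>X\<in>cohomology G k. \<forall>Y\<in>cohomology G k. F (class_add X Y) = class_add (F X) (F Y)) \<and>
        (\<forall>c. \<forall>X\<in>cohomology G k. F (class_scale G k c X) = class_scale H k c (F X)))"

end

theory Submission
  imports Defs
begin

text \<open>Invariance under homotopy steps yields only an abstract linear bijection between the
  cohomology of a unit sphere and that of a point, not one induced by a map of graphs. Exactness of
  the augmented complex must therefore be recovered from sizes alone: higher cohomology is a single
  class, and in degree 0 the constants already fill a one-dimensional space. That bijection is at
  hand because contractibility of the sphere is a derivation of the same inductive relation, so a
  single induction covers both.

  Cochains are indexed by the length of the list rather than by degree. The augmentation term is
  then just the functions supported on the empty list, and deleting \<open>z\<close> merely shortens
  lists by one. In place of a long exact sequence, two facts about the kernel are used directly: its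
  closed forms have primitives inside it, and in lowest degree they vanish.\<close>

text \<open>
  A homeomorphism restricts to an isomorphism of nerve graphs, and each nerve is homotopic to its
  graph, so it suffices that cohomology is invariant under isomorphisms and homotopy steps. Let
  \<open>z\<close> be a vertex whose unit sphere \<open>S\<close> has the cohomology of a point. Restriction of forms
  from \<open>G\<close> to \<open>G - z\<close> is surjective, and its kernel consists of the forms supported on cliques
  containing \<open>z\<close>. Deleting \<open>z\<close> from these cliques identifies the kernel, up to sign and a shift
  of degree, with the augmented cochain complex of \<open>S\<close>, which is exact. Hence restriction induces
  an isomorphism in cohomology.
\<close>

subsection \<open>Cochains\<close>

definition clique :: "'a graph \<Rightarrow> 'a list \<Rightarrow> bool" where
  "clique G xs \<longleftrightarrow> distinct xs \<and> set xs \<subseteq> verts G \<and>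
     (\<forall>x\<in>set xs. \<forall>y\<in>set xs. x \<noteq> y \<longrightarrow> {x, y} \<in> edges G)"

text \<open>Adjacent transpositions generate the symmetric group, and swaps at a split point of a
  list fit structural recursion better than permutations of positions.\<close>

definition alternating :: "('a list \<Rightarrow> real) \<Rightarrow> bool" where
  "alternating f \<longleftrightarrow> (\<forall>as a b bs. f (as @ a # b # bs) = - f (as @ b # a # bs))"

text \<open>Here \<open>n\<close> is the number of vertices, so forms of degree \<open>k\<close>
  appear as \<open>n = Suc k\<close>. The extra case \<open>n = 0\<close> consists of the multiples
  of the indicator of \<open>[]\<close>.\<close>

definition cochains :: "'a graph \<Rightarrow> nat \<Rightarrow> ('a list \<Rightarrow> real) set" where
  "cochains G n = {f. alternating f \<and> (\<forall>xs. f xs \<noteq> 0 \<longrightarrow> clique G xs \<and> length xs = n)}"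

text \<open>The recursion splits off the first vertex: all other faces keep it, with the opposite sign.\<close>

fun face_sum :: "('a list \<Rightarrow> real) \<Rightarrow> 'a list \<Rightarrow> real" where
  "face_sum f [] = 0"
| "face_sum f (x # xs) = f xs - face_sum (\<lambda>ys. f (x # ys)) xs"

definition cobd :: "'a graph \<Rightarrow> ('a list \<Rightarrow> real) \<Rightarrow> 'a list \<Rightarrow> real" where
  "cobd G f xs = (if clique G xs then face_sum f xs else 0)"

lemma clique_cong: "mset xs = mset ys \<Longrightarrow> clique G xs \<longleftrightarrow> clique G ys"
  unfolding clique_def by (metis mset_eq_imp_distinct_iff mset_eq_setD)

lemma clique_face: "clique G (as @ a # bs) \<Longrightarrow> clique G (as @ bs)"
  unfolding clique_def by auto

lemma alternatingI:
  "(\<And>as a b bs. f (as @ a # b # bs) = - f (as @ b # a # bs)) \<Longrightarrow> alternating f"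
  unfolding alternating_def by blast

lemma alternatingD: "alternating f \<Longrightarrow> f (as @ a # b # bs) = - f (as @ b # a # bs)"
  unfolding alternating_def by blast

lemma alternating_Cons: "alternating f \<Longrightarrow> alternating (\<lambda>ys. f (x # ys))"
  unfolding alternating_def by (metis append_Cons)

lemma alternating_move:
  "alternating f \<Longrightarrow> f (as @ z # bs) = (-1) ^ length as * f (z # as @ bs)"
proof (induction as arbitrary: f)
  case (Cons a as)
  then show ?case
    using Cons.IH[OF alternating_Cons[OF Cons.prems], of a]
      alternatingD[OF Cons.prems, of "[]" a z "as @ bs"] by simp
qed simp

text \<open>\<open>a\<close> crosses \<open>c\<close>, the induction hypothesis exchanges
  \<open>a\<close> and \<open>b\<close> across the rest, and \<open>b\<close> crosses
  \<open>c\<close>: three sign changes amount to one.\<close>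

lemma alternating_swap:
  assumes "alternating f"
  shows "f (as @ a # ms @ b # bs) = - f (as @ b # ms @ a # bs)"
proof (induction ms arbitrary: as)
  case Nil
  then show ?case using alternatingD[OF assms, of as a b bs] by simp
next
  case (Cons c ms)
  have "f (as @ a # (c # ms) @ b # bs) = - f ((as @ [c]) @ a # ms @ b # bs)"
    using alternatingD[OF assms, of as a c "ms @ b # bs"] by simp
  also have "\<dots> = f ((as @ [c]) @ b # ms @ a # bs)"
    using Cons.IH[of "as @ [c]"] by simp
  also have "\<dots> = - f (as @ b # (c # ms) @ a # bs)"
    using alternatingD[OF assms, of as c b "ms @ a # bs"] by simp
  finally show ?case .
qed

lemma permute_list_transpose_append:
  fixes as ms bs :: "'a list"
  defines "i \<equiv> length as" and "j \<equiv> Suc (length as + length ms)"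
  shows "permute_list (Transposition.transpose i j) (as @ a # ms @ b # bs) = as @ b # ms @ a # bs"
proof -
  have nth: "(as @ x # ms @ y # bs) ! l =
      (if l < i then as ! l else if l = i then x else if l < j then ms ! (l - Suc i)
       else if l = j then y else bs ! (l - Suc j))" for x y l
  proof -
    have "l - i = Suc (l - Suc i)" if "i < l" using that by simp
    moreover have "l - Suc i - length ms = Suc (l - Suc j)" if "j < l"
      using that by (simp add: i_def j_def)
    ultimately show ?thesis
      by (auto simp: nth_append i_def j_def)
  qed
  have "i < j" by (simp add: i_def j_def)
  show ?thesis
  proof (rule nth_equalityI)
    fix l assume l: "l < length (permute_list (Transposition.transpose i j) (as @ a # ms @ b # bs))"
    then have "permute_list (Transposition.transpose i j) (as @ a # ms @ b # bs) ! l =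
        (as @ a # ms @ b # bs) ! Transposition.transpose i j l"
      using nth_upt[of 0 l "length (as @ a # ms @ b # bs)"]
      unfolding permute_list_def by (subst nth_map) (simp_all del: upt_Suc)
    also have "\<dots> = (as @ b # ms @ a # bs) ! l"
      using \<open>i < j\<close> unfolding nth Transposition.transpose_def by auto
    finally show "permute_list (Transposition.transpose i j) (as @ a # ms @ b # bs) ! l =
        (as @ b # ms @ a # bs) ! l" .
  qed simp
qed

text \<open>Peel transpositions off \<open>p\<close> on the right: by
  \<open>permute_list_compose\<close> each one acts on the positions of the list already permuted by
  the rest, where \<open>alternating_swap\<close> applies.\<close>

lemma alternating_permute_list:
  assumes "alternating f" and "p permutes {..<length xs}"
  shows "f (permute_list p xs) = of_int (sign p) * f xs"
proof -
  have "finite {..<length xs}" by simp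
  from this assms(2) show ?thesis
  proof (induction p rule: permutes_rev_induct)
    case id
    then show ?case by simp
  next
    case (swap a b p)
    have swap_nth: "f (permute_list (Transposition.transpose i j) ys) = - f ys" if "i < j" "j < length ys" for i j ys
    proof -
      define as ms bs where "as = take i ys" "ms = take (j - Suc i) (drop (Suc i) ys)" "bs = drop (Suc j) ys"
      have "drop (Suc i) ys = ms @ drop (j - Suc i) (drop (Suc i) ys)"
        unfolding as_ms_bs_def by (rule append_take_drop_id[symmetric])
      also have "drop (j - Suc i) (drop (Suc i) ys) = ys ! j # bs"
        using that by (simp add: as_ms_bs_def Cons_nth_drop_Suc)
      finally have eq: "ys = as @ ys ! i # ms @ ys ! j # bs"
        using that by (metis as_ms_bs_def(1) id_take_nth_drop less_trans)
      have i: "i = length as" and j: "j = Suc (length as + length ms)"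
        using that by (auto simp: as_ms_bs_def)
      show ?thesis
        using permute_list_transpose_append[of as ms "ys ! i" "ys ! j" bs] eq i j
          alternating_swap[OF assms(1), of as "ys ! i" ms "ys ! j" bs] by simp
    qed
    have tr: "Transposition.transpose a b permutes {..<length xs}"
      using swap(1,2) by (rule permutes_swap_id)
    have "f (permute_list (Transposition.transpose a b) (permute_list p xs)) = - f (permute_list p xs)"
    proof (cases "a < b")
      case True
      then show ?thesis using swap(2) by (intro swap_nth) auto
    next
      case False
      then show ?thesis
        using swap(1,3) by (subst transpose_commute, intro swap_nth) auto
    qed
    then have "f (permute_list (p \<circ> Transposition.transpose a b) xs) = - f (permute_list p xs)"
      by (simp add: permute_list_compose[OF tr])
    moreover have "sign (p \<circ> Transposition.transpose a b) = - sign p"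
    proof -
      have "permutation p"
        using swap.hyps(4) by (intro iffD2[OF permutation_permutes] exI[of _ "{..<length xs}"]) simp
      then have "sign (p \<circ> Transposition.transpose a b) = sign p * sign (Transposition.transpose a b)"
        by (rule sign_compose[OF _ permutation_swap_id])
      then show ?thesis
        using swap(3) by (simp add: sign_swap_id)
    qed
    ultimately show ?case using swap.IH by (simp only: of_int_minus mult_minus_left)
  qed
qed

lemma ordered_cliques_iff: "xs \<in> ordered_cliques G k \<longleftrightarrow> clique G xs \<and> length xs = Suc k"
  unfolding ordered_cliques_def clique_def by auto

text \<open>One direction applies the sign rule to adjacent transpositions. Off cliques both values
  are 0, since being a clique does not depend on the order of the list.\<close>

lemma forms_eq_cochains: "forms G k = cochains G (Suc k)"
proof (intro equalityI subsetI)
  fix f assume f: "f \<in> forms G k"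
  have "f (as @ a # b # bs) = - f (as @ b # a # bs)" for as a b bs
  proof (cases "as @ b # a # bs \<in> ordered_cliques G k")
    case True
    let ?p = "Transposition.transpose (length as) (Suc (length as))"
    have "?p permutes {..k}"
      using True by (intro permutes_swap_id) (auto simp: ordered_cliques_iff)
    then have "f (permute_list ?p (as @ b # a # bs)) = of_int (sign ?p) * f (as @ b # a # bs)"
      using f True by (simp add: forms_def)
    then show ?thesis
      using permute_list_transpose_append[of as "[]" b a bs] by (simp add: sign_swap_id)
  next
    case False
    then have "as @ a # b # bs \<notin> ordered_cliques G k"
      using clique_cong[of "as @ b # a # bs" "as @ a # b # bs" G] by (simp add: ordered_cliques_iff)
    then show ?thesis
      using f False by (simp add: forms_def)
  qed
  then have "alternating f" unfolding alternating_def by blast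
  then show "f \<in> cochains G (Suc k)"
    using f by (auto simp: forms_def cochains_def ordered_cliques_iff)
next
  fix f assume "f \<in> cochains G (Suc k)"
  then show "f \<in> forms G k"
    using alternating_permute_list[of f]
    by (auto simp: forms_def cochains_def ordered_cliques_iff lessThan_Suc_atMost)
qed

section \<open>The coboundary operator\<close>

lemma face_sum_cong:
  "(\<And>as a bs. xs = as @ a # bs \<Longrightarrow> f (as @ bs) = g (as @ bs)) \<Longrightarrow> face_sum f xs = face_sum g xs"
proof (induction xs arbitrary: f g)
  case (Cons x xs)
  have "face_sum (\<lambda>ys. f (x # ys)) xs = face_sum (\<lambda>ys. g (x # ys)) xs"
    by (rule Cons.IH) (metis Cons.prems append_Cons)
  then show ?case using Cons.prems[of "[]" x xs] by simp
qed simp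

lemma face_sum_zero [simp]: "face_sum (\<lambda>_. 0) xs = 0"
  by (induction xs) auto

lemma face_sum_add: "face_sum (\<lambda>ys. f ys + g ys) xs = face_sum f xs + face_sum g xs"
  by (induction xs arbitrary: f g) auto

lemma face_sum_scale: "face_sum (\<lambda>ys. c * f ys) xs = c * face_sum f xs"
  by (induction xs arbitrary: f) (auto simp: algebra_simps)

lemma face_sum_minus: "face_sum (\<lambda>ys. - f ys) xs = - face_sum f xs"
  using face_sum_scale[of "-1"] by simp

lemma face_sum_diff: "face_sum (\<lambda>ys. f ys - g ys) xs = face_sum f xs - face_sum g xs"
  using face_sum_add[of f "\<lambda>ys. - g ys"] by (simp add: face_sum_minus)

text \<open>Splitting off the head \<open>x\<close> in both sums, the two terms in which
  \<open>x\<close> is deleted exactly once cancel. What is left is the same double sum for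
  \<open>\<lambda>ys. f (x # ys)\<close>.\<close>

lemma face_sum_face_sum: "face_sum (face_sum f) xs = 0"
  by (induction xs arbitrary: f) (auto simp: face_sum_diff)

lemma face_sum_eq_sum:
  "face_sum f xs = (\<Sum>j<length xs. (-1) ^ j * f (take j xs @ drop (Suc j) xs))"
proof (induction xs arbitrary: f)
  case (Cons x xs)
  then show ?case
    by (simp add: sum.lessThan_Suc_shift sum_negf del: sum.lessThan_Suc)
qed simp

lemma ext_deriv_eq_cobd:
  assumes "f \<in> cochains G (Suc k)"
  shows "ext_deriv G k f = cobd G f"
proof
  fix xs
  \<comment> \<open>\<open>cobd\<close> has no cutoff by length, unlike \<open>ext_deriv\<close>;
    for a wrong length every face lies outside the support of \<open>f\<close>.\<close>
  have "face_sum f xs = 0" if "length xs \<noteq> Suc (Suc k)"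
    using that assms face_sum_cong[of xs f "\<lambda>_. 0"] by (force simp: cochains_def)
  then show "ext_deriv G k f xs = cobd G f xs"
    by (auto simp: ext_deriv_def cobd_def ordered_cliques_iff face_sum_eq_sum lessThan_Suc_atMost
        simp del: sum.atMost_Suc)
qed

lemma alternating_face_sum:
  assumes "alternating f"
  shows "alternating (face_sum f)"
proof (rule alternatingI)
  fix as a b bs
  show "face_sum f (as @ a # b # bs) = - face_sum f (as @ b # a # bs)"
    using assms
  proof (induction as arbitrary: f)
    case Nil
    \<comment> \<open>The faces omitting \<open>a\<close> or \<open>b\<close> have opposite signs
      and trade places under the swap; all other faces contain both vertices.\<close>
    have "face_sum (\<lambda>ys. f (a # b # ys)) bs = - face_sum (\<lambda>ys. f (b # a # ys)) bs"
      unfolding face_sum_minus[symmetric]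
      using alternatingD[OF Nil, of "[]" a b] by (intro face_sum_cong) (metis append_Nil)
    then show ?case by simp
  next
    case (Cons x as)
    show ?case
      using Cons.IH[OF alternating_Cons[OF Cons.prems], of x] alternatingD[OF Cons.prems, of as a b bs]
      by simp
  qed
qed

lemma cobd_in_cochains:
  assumes "f \<in> cochains G n"
  shows "cobd G f \<in> cochains G (Suc n)"
proof -
  have "alternating (cobd G f)"
  proof (rule alternatingI)
    fix as a b bs
    have "alternating (face_sum f)"
      using assms by (simp add: cochains_def alternating_face_sum)
    from alternatingD[OF this, of as a b bs]
    show "cobd G f (as @ a # b # bs) = - cobd G f (as @ b # a # bs)"
      using clique_cong[of "as @ a # b # bs" "as @ b # a # bs" G] by (simp add: cobd_def)
  qed
  moreover have "length xs = Suc n" if "cobd G f xs \<noteq> 0" for xs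
  proof (rule ccontr)
    assume "length xs \<noteq> Suc n"
    then have "face_sum f xs = face_sum (\<lambda>_. 0) xs"
      using assms by (intro face_sum_cong) (force simp: cochains_def)
    then show False using that by (simp add: cobd_def split: if_splits)
  qed
  ultimately show ?thesis by (auto simp: cochains_def cobd_def)
qed

text \<open>Faces of a clique are cliques, so the inner cutoff is invisible on cliques.\<close>

lemma cobd_cobd: "cobd G (cobd G f) = (\<lambda>_. 0)"
proof
  fix xs
  have "face_sum (cobd G f) xs = face_sum (face_sum f) xs" if "clique G xs"
    using that clique_face[of G] by (intro face_sum_cong) (simp add: cobd_def)
  then show "cobd G (cobd G f) xs = 0"
    by (simp add: cobd_def[of G "cobd G f"] face_sum_face_sum)
qed

lemma cobd_zero [simp]: "cobd G (\<lambda>_. 0) = (\<lambda>_. 0)"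
  by (auto simp: cobd_def)

lemma cobd_add: "cobd G (\<lambda>xs. f xs + g xs) = (\<lambda>xs. cobd G f xs + cobd G g xs)"
  by (auto simp: cobd_def face_sum_add)

lemma cobd_scale: "cobd G (\<lambda>xs. c * f xs) = (\<lambda>xs. c * cobd G f xs)"
  by (auto simp: cobd_def face_sum_scale)

lemma cobd_diff: "cobd G (\<lambda>xs. f xs - g xs) = (\<lambda>xs. cobd G f xs - cobd G g xs)"
  by (auto simp: cobd_def face_sum_diff)

lemma cochains_zero [simp]: "(\<lambda>_. 0) \<in> cochains G n"
  by (auto simp: cochains_def intro!: alternatingI)

lemma cochains_add:
  assumes "f \<in> cochains G n" "g \<in> cochains G n"
  shows "(\<lambda>xs. f xs + g xs) \<in> cochains G n"
proof -
  have "alternating (\<lambda>xs. f xs + g xs)"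
  proof (rule alternatingI)
    fix as a b bs
    show "f (as @ a # b # bs) + g (as @ a # b # bs) = - (f (as @ b # a # bs) + g (as @ b # a # bs))"
      using assms alternatingD[of f as a b bs] alternatingD[of g as a b bs] by (simp add: cochains_def)
  qed
  moreover have "clique G xs \<and> length xs = n" if "f xs + g xs \<noteq> 0" for xs
    using that assms by (cases "f xs = 0") (simp_all add: cochains_def)
  ultimately show ?thesis
    by (simp add: cochains_def)
qed

lemma cochains_scale:
  assumes "f \<in> cochains G n"
  shows "(\<lambda>xs. c * f xs) \<in> cochains G n"
proof -
  have "alternating (\<lambda>xs. c * f xs)"
  proof (rule alternatingI)
    fix as a b bs
    show "c * f (as @ a # b # bs) = - (c * f (as @ b # a # bs))"
      using assms alternatingD[of f as a b bs] by (simp add: cochains_def)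
  qed
  then show ?thesis
    using assms by (auto simp: cochains_def)
qed

lemma cochains_diff:
  assumes "f \<in> cochains G n" "g \<in> cochains G n"
  shows "(\<lambda>xs. f xs - g xs) \<in> cochains G n"
  using cochains_add[OF assms(1) cochains_scale[OF assms(2), of "-1"]] by simp

section \<open>Spaces of cocycles and coboundaries\<close>

lemma cocycles_iff: "f \<in> cocycles G k \<longleftrightarrow> f \<in> cochains G (Suc k) \<and> cobd G f = (\<lambda>_. 0)"
  by (auto simp: cocycles_def forms_eq_cochains ext_deriv_eq_cobd)

lemma coboundaries_0: "coboundaries G 0 = {\<lambda>_. 0}"
  by (simp add: coboundaries_def)

lemma coboundaries_Suc: "coboundaries G (Suc m) = cobd G ` cochains G (Suc m)"
  by (simp add: coboundaries_def forms_eq_cochains ext_deriv_eq_cobd)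

lemma coboundaries_subset_cocycles: "coboundaries G k \<subseteq> cocycles G k"
  by (cases k) (auto simp: coboundaries_0 coboundaries_Suc cocycles_iff cobd_cobd cobd_in_cochains)

lemma cocycles_zero [simp]: "(\<lambda>_. 0) \<in> cocycles G k"
  by (simp add: cocycles_iff)

lemma cocycles_add:
  "f \<in> cocycles G k \<Longrightarrow> g \<in> cocycles G k \<Longrightarrow> (\<lambda>xs. f xs + g xs) \<in> cocycles G k"
  by (simp add: cocycles_iff cochains_add cobd_add)

lemma cocycles_scale: "f \<in> cocycles G k \<Longrightarrow> (\<lambda>xs. c * f xs) \<in> cocycles G k"
  by (simp add: cocycles_iff cochains_scale cobd_scale)

lemma cocycles_diff:
  "f \<in> cocycles G k \<Longrightarrow> g \<in> cocycles G k \<Longrightarrow> (\<lambda>xs. f xs - g xs) \<in> cocycles G k"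
  by (simp add: cocycles_iff cochains_diff cobd_diff)

lemma coboundaries_zero [simp]: "(\<lambda>_. 0) \<in> coboundaries G k"
proof (cases k)
  case (Suc m)
  show ?thesis unfolding Suc coboundaries_Suc
    by (rule image_eqI[where x="\<lambda>_. 0"]) simp_all
qed (simp add: coboundaries_0)

lemma coboundaries_add:
  "f \<in> coboundaries G k \<Longrightarrow> g \<in> coboundaries G k \<Longrightarrow> (\<lambda>xs. f xs + g xs) \<in> coboundaries G k"
  by (cases k) (auto simp: coboundaries_0 coboundaries_Suc cobd_add[symmetric] cochains_add)

lemma coboundaries_scale: "f \<in> coboundaries G k \<Longrightarrow> (\<lambda>xs. c * f xs) \<in> coboundaries G k"
  by (cases k) (auto simp: coboundaries_0 coboundaries_Suc cobd_scale[symmetric] cochains_scale)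

lemma coboundaries_diff:
  assumes "f \<in> coboundaries G k" "g \<in> coboundaries G k"
  shows "(\<lambda>xs. f xs - g xs) \<in> coboundaries G k"
  using coboundaries_add[OF assms(1) coboundaries_scale[OF assms(2), of "-1"]] by simp

subsection \<open>Cohomology classes\<close>

definition hclass :: "'a graph \<Rightarrow> nat \<Rightarrow> ('a list \<Rightarrow> real) \<Rightarrow> ('a list \<Rightarrow> real) set" where
  "hclass G k f = {g \<in> cocycles G k. (\<lambda>xs. f xs - g xs) \<in> coboundaries G k}"

lemma cohomology_eq: "cohomology G k = hclass G k ` cocycles G k"
  unfolding cohomology_def quotient_def hclass_def by auto

lemma hclass_self: "f \<in> cocycles G k \<Longrightarrow> f \<in> hclass G k f"
  by (simp add: hclass_def)

lemma hclass_eq_iff: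
  assumes "f \<in> cocycles G k" "g \<in> cocycles G k"
  shows "hclass G k f = hclass G k g \<longleftrightarrow> (\<lambda>xs. f xs - g xs) \<in> coboundaries G k"
proof
  assume "hclass G k f = hclass G k g"
  then have "g \<in> hclass G k f"
    using hclass_self[OF assms(2)] by simp
  then show "(\<lambda>xs. f xs - g xs) \<in> coboundaries G k"
    by (simp add: hclass_def)
next
  assume fg: "(\<lambda>xs. f xs - g xs) \<in> coboundaries G k"
  have "(\<lambda>xs. f xs - h xs) \<in> coboundaries G k \<longleftrightarrow> (\<lambda>xs. g xs - h xs) \<in> coboundaries G k" for h
  proof
    assume "(\<lambda>xs. f xs - h xs) \<in> coboundaries G k"
    from coboundaries_diff[OF this fg] show "(\<lambda>xs. g xs - h xs) \<in> coboundaries G k" by simp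
  next
    assume "(\<lambda>xs. g xs - h xs) \<in> coboundaries G k"
    from coboundaries_add[OF fg this] show "(\<lambda>xs. f xs - h xs) \<in> coboundaries G k" by simp
  qed
  then show "hclass G k f = hclass G k g"
    by (simp add: hclass_def)
qed

lemma class_add_hclass:
  assumes f: "f \<in> cocycles G k" and g: "g \<in> cocycles G k"
  shows "class_add (hclass G k f) (hclass G k g) = hclass G k (\<lambda>xs. f xs + g xs)"
proof (intro equalityI subsetI)
  fix h assume "h \<in> class_add (hclass G k f) (hclass G k g)"
  then obtain f' g' where h: "h = (\<lambda>xs. f' xs + g' xs)" and *: "f' \<in> hclass G k f" "g' \<in> hclass G k g"
    by (auto simp: class_add_def)
  then show "h \<in> hclass G k (\<lambda>xs. f xs + g xs)"
    using cocycles_add[of f' G k g'] coboundaries_add[of "\<lambda>xs. f xs - f' xs" G k "\<lambda>xs. g xs - g' xs"]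
    by (simp add: hclass_def algebra_simps)
next
  fix h assume h: "h \<in> hclass G k (\<lambda>xs. f xs + g xs)"
  \<comment> \<open>Keep the representative \<open>f\<close> of the first class and let the second
    summand absorb the rest of \<open>h\<close>.\<close>
  have "(\<lambda>xs. h xs - f xs) \<in> hclass G k g"
    using h cocycles_diff[of h G k f] f by (simp add: hclass_def algebra_simps)
  moreover have "h = (\<lambda>xs. f xs + (h xs - f xs))" by simp
  ultimately show "h \<in> class_add (hclass G k f) (hclass G k g)"
    using hclass_self[OF f] unfolding class_add_def
    by (intro CollectI exI[of _ f] exI[of _ "\<lambda>xs. h xs - f xs"] conjI)
qed

lemma class_scale_hclass:
  assumes f: "f \<in> cocycles G k"
  shows "class_scale G k c (hclass G k f) = hclass G k (\<lambda>xs. c * f xs)"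
proof (intro equalityI subsetI)
  fix h assume "h \<in> class_scale G k c (hclass G k f)"
  then obtain f' b where h: "h = (\<lambda>xs. c * f' xs + b xs)"
    and *: "f' \<in> hclass G k f" "b \<in> coboundaries G k"
    by (auto simp: class_scale_def)
  have "b \<in> cocycles G k" using * coboundaries_subset_cocycles by blast
  then have "h \<in> cocycles G k"
    using * unfolding h by (intro cocycles_add cocycles_scale) (auto simp: hclass_def)
  moreover have "(\<lambda>xs. c * (f xs - f' xs) - b xs) \<in> coboundaries G k"
    using * coboundaries_diff[OF coboundaries_scale[of "\<lambda>xs. f xs - f' xs" G k c], of b]
    by (simp add: hclass_def)
  ultimately show "h \<in> hclass G k (\<lambda>xs. c * f xs)"
    unfolding hclass_def by (simp add: h algebra_simps)
next
  fix h assume h: "h \<in> hclass G k (\<lambda>xs. c * f xs)"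
  \<comment> \<open>Dividing \<open>h\<close> by \<open>c\<close> would fail for
    \<open>c = 0\<close>; the difference of \<open>h\<close> and \<open>c\<close> times
    \<open>f\<close> goes into the coboundary summand of \<open>class_scale\<close> instead.\<close>
  have "(\<lambda>xs. -1 * (c * f xs - h xs)) \<in> coboundaries G k"
    using h by (intro coboundaries_scale) (auto simp: hclass_def)
  moreover have "h = (\<lambda>xs. c * f xs + -1 * (c * f xs - h xs))" by simp
  ultimately show "h \<in> class_scale G k c (hclass G k f)"
    using hclass_self[OF f] unfolding class_scale_def
    by (intro CollectI exI[of _ f] exI[of _ "\<lambda>xs. -1 * (c * f xs - h xs)"] conjI)
qed

lemma class_add_in_cohomology:
  "X \<in> cohomology G k \<Longrightarrow> Y \<in> cohomology G k \<Longrightarrow> class_add X Y \<in> cohomology G k"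
  by (auto simp: cohomology_eq class_add_hclass intro!: imageI cocycles_add)

lemma class_scale_in_cohomology: "X \<in> cohomology G k \<Longrightarrow> class_scale G k c X \<in> cohomology G k"
  by (auto simp: cohomology_eq class_scale_hclass intro!: imageI cocycles_scale)

text \<open>The bijection is the set image under \<open>r\<close>. It sends a class onto a whole
  class because \<open>r\<close> is onto on cocycles and reflects coboundaries; \<open>r\<close> may
  well have a kernel, as restriction of forms does.\<close>

lemma cohomology_isomorphicI:
  fixes r :: "('a list \<Rightarrow> real) \<Rightarrow> ('b list \<Rightarrow> real)"
  assumes add: "\<And>f g. r (\<lambda>xs. f xs + g xs) = (\<lambda>xs. r f xs + r g xs)"
    and scale: "\<And>c f. r (\<lambda>xs. c * f xs) = (\<lambda>xs. c * r f xs)"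
    and onto: "r ` cocycles G k = cocycles H k"
    and cob: "\<And>f. f \<in> cocycles G k \<Longrightarrow> r f \<in> coboundaries H k \<longleftrightarrow> f \<in> coboundaries G k"
  shows "cohomology_isomorphic k G H"
proof -
  have diff: "r (\<lambda>xs. f xs - g xs) = (\<lambda>xs. r f xs - r g xs)" for f g
    using add[of f "\<lambda>xs. -1 * g xs"] scale[of "-1" g] by simp
  have im: "r ` hclass G k f = hclass H k (r f)" if f: "f \<in> cocycles G k" for f
  proof -
    have "r g \<in> hclass H k (r f) \<longleftrightarrow> g \<in> hclass G k f" if g: "g \<in> cocycles G k" for g
      using onto g cob[OF cocycles_diff[OF f g]] by (auto simp: hclass_def diff)
    moreover have "hclass H k (r f) \<subseteq> r ` cocycles G k"
      unfolding onto by (auto simp: hclass_def)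
    moreover have "hclass G k f \<subseteq> cocycles G k"
      by (auto simp: hclass_def)
    ultimately show ?thesis by blast
  qed
  have "inj_on (image r) (cohomology G k)"
  proof (rule inj_onI)
    fix X Y assume "X \<in> cohomology G k" "Y \<in> cohomology G k" and eq: "r ` X = r ` Y"
    then obtain f g where fg: "f \<in> cocycles G k" "g \<in> cocycles G k" "X = hclass G k f" "Y = hclass G k g"
      by (auto simp: cohomology_eq)
    moreover have "r f \<in> cocycles H k" "r g \<in> cocycles H k"
      using fg onto by auto
    ultimately show "X = Y"
      using eq cob[OF cocycles_diff[of f G k g]] by (simp add: im hclass_eq_iff diff)
  qed
  moreover have "image r ` cohomology G k = cohomology H k"
    unfolding cohomology_eq onto[symmetric] image_image by (rule image_cong) (simp_all add: im)
  moreover have "r ` class_add X Y = class_add (r ` X) (r ` Y)" for X Y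
  proof (intro equalityI subsetI)
    fix h assume "h \<in> r ` class_add X Y"
    then obtain f g where "f \<in> X" "g \<in> Y" "h = (\<lambda>xs. r f xs + r g xs)"
      by (auto simp: class_add_def add)
    then show "h \<in> class_add (r ` X) (r ` Y)"
      unfolding class_add_def by blast
  next
    fix h assume "h \<in> class_add (r ` X) (r ` Y)"
    then obtain f g where "f \<in> X" "g \<in> Y" "h = r (\<lambda>xs. f xs + g xs)"
      by (auto simp: class_add_def add)
    then show "h \<in> r ` class_add X Y"
      unfolding class_add_def by blast
  qed
  moreover have "r ` class_scale G k c X = class_scale H k c (r ` X)" if X: "X \<in> cohomology G k" for c X
  proof -
    obtain f where f: "f \<in> cocycles G k" "X = hclass G k f"
      using X by (auto simp: cohomology_eq)
    moreover have "r f \<in> cocycles H k" using f onto by auto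
    ultimately show ?thesis
      by (simp add: class_scale_hclass im cocycles_scale scale)
  qed
  ultimately show ?thesis
    unfolding cohomology_isomorphic_def bij_betw_def by (intro exI[of _ "image r"]) simp
qed

lemma cohomology_isomorphic_sym:
  assumes "cohomology_isomorphic k G H"
  shows "cohomology_isomorphic k H G"
proof -
  obtain F where F: "bij_betw F (cohomology G k) (cohomology H k)"
    and add: "\<And>X Y. X \<in> cohomology G k \<Longrightarrow> Y \<in> cohomology G k \<Longrightarrow> F (class_add X Y) = class_add (F X) (F Y)"
    and scale: "\<And>c X. X \<in> cohomology G k \<Longrightarrow> F (class_scale G k c X) = class_scale H k c (F X)"
    using assms unfolding cohomology_isomorphic_def by blast
  let ?I = "inv_into (cohomology G k) F"
  have I: "bij_betw ?I (cohomology H k) (cohomology G k)"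
    using F by (rule bij_betw_inv_into)
  have FI: "F (?I X) = X" "?I X \<in> cohomology G k" if "X \<in> cohomology H k" for X
    using bij_betw_inv_into_right[OF F that] bij_betw_apply[OF I that] by simp_all
  have IF: "?I (F X) = X" if "X \<in> cohomology G k" for X
    using bij_betw_inv_into_left[OF F that] .
  have "?I (class_add X Y) = class_add (?I X) (?I Y)"
    if "X \<in> cohomology H k" "Y \<in> cohomology H k" for X Y
    using add[of "?I X" "?I Y"] FI[OF that(1)] FI[OF that(2)]
      IF[OF class_add_in_cohomology[of "?I X" G k "?I Y"]] by simp
  moreover have "?I (class_scale H k c X) = class_scale G k c (?I X)"
    if "X \<in> cohomology H k" for c X
    using scale[of "?I X" c] FI[OF that] IF[OF class_scale_in_cohomology[of "?I X" G k c]] by simp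
  ultimately show ?thesis
    using I unfolding cohomology_isomorphic_def by (intro exI[of _ ?I]) simp
qed

lemma cohomology_isomorphic_trans [trans]:
  assumes "cohomology_isomorphic k G H" "cohomology_isomorphic k H K"
  shows "cohomology_isomorphic k G K"
proof -
  obtain F where F: "bij_betw F (cohomology G k) (cohomology H k)"
    "\<forall>X\<in>cohomology G k. \<forall>Y\<in>cohomology G k. F (class_add X Y) = class_add (F X) (F Y)"
    "\<forall>c. \<forall>X\<in>cohomology G k. F (class_scale G k c X) = class_scale H k c (F X)"
    using assms(1) unfolding cohomology_isomorphic_def by blast
  obtain F' where F': "bij_betw F' (cohomology H k) (cohomology K k)"
    "\<forall>X\<in>cohomology H k. \<forall>Y\<in>cohomology H k. F' (class_add X Y) = class_add (F' X) (F' Y)"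
    "\<forall>c. \<forall>X\<in>cohomology H k. F' (class_scale H k c X) = class_scale K k c (F' X)"
    using assms(2) unfolding cohomology_isomorphic_def by blast
  have "F X \<in> cohomology H k" if "X \<in> cohomology G k" for X
    using bij_betw_apply[OF F(1) that] .
  then show ?thesis
    using F F' bij_betw_trans[OF F(1) F'(1)] unfolding cohomology_isomorphic_def
    by (intro exI[of _ "F' \<circ> F"]) simp
qed

lemma cohomology_isomorphic_refl: "cohomology_isomorphic k G G"
  by (rule cohomology_isomorphicI[of "\<lambda>f. f"]) auto

subsection \<open>Isomorphic graphs\<close>

text \<open>Outside \<open>verts G\<close> the map is arbitrary and could send a list to a clique of
  the target, hence the cutoff.\<close>

definition pull :: "('a \<Rightarrow> 'b) \<Rightarrow> 'a graph \<Rightarrow> ('b list \<Rightarrow> real) \<Rightarrow> 'a list \<Rightarrow> real" where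
  "pull \<phi> G f xs = (if set xs \<subseteq> verts G then f (map \<phi> xs) else 0)"

definition iso_map :: "('a \<Rightarrow> 'b) \<Rightarrow> 'a graph \<Rightarrow> 'b graph \<Rightarrow> bool" where
  "iso_map \<phi> G H \<longleftrightarrow> bij_betw \<phi> (verts G) (verts H) \<and>
     (\<forall>x\<in>verts G. \<forall>y\<in>verts G. {x, y} \<in> edges G \<longleftrightarrow> {\<phi> x, \<phi> y} \<in> edges H)"

lemma iso_map_inv:
  assumes "iso_map \<phi> G H"
  shows "iso_map (inv_into (verts G) \<phi>) H G"
proof -
  let ?I = "inv_into (verts G) \<phi>"
  have b: "bij_betw \<phi> (verts G) (verts H)" using assms by (simp add: iso_map_def)
  then have bI: "bij_betw ?I (verts H) (verts G)" by (rule bij_betw_inv_into)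
  have "{x, y} \<in> edges H \<longleftrightarrow> {?I x, ?I y} \<in> edges G" if "x \<in> verts H" "y \<in> verts H" for x y
  proof -
    have "?I x \<in> verts G" "?I y \<in> verts G" "\<phi> (?I x) = x" "\<phi> (?I y) = y"
      using bij_betw_inv_into_right[OF b] bij_betw_apply[OF bI] that by simp_all
    then show ?thesis using assms by (auto simp: iso_map_def)
  qed
  then show ?thesis using bI by (simp add: iso_map_def)
qed

lemma clique_map:
  assumes "iso_map \<phi> G H" "set xs \<subseteq> verts G"
  shows "clique H (map \<phi> xs) \<longleftrightarrow> clique G xs"
proof -
  have inj: "inj_on \<phi> (verts G)" and im: "\<phi> ` verts G = verts H"
    using assms(1) by (auto simp: iso_map_def bij_betw_def)
  have "inj_on \<phi> (set xs)" using inj assms(2) by (rule inj_on_subset)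
  then have d: "distinct (map \<phi> xs) \<longleftrightarrow> distinct xs"
    by (simp add: distinct_map)
  have e: "{\<phi> x, \<phi> y} \<in> edges H \<longleftrightarrow> {x, y} \<in> edges G" "\<phi> x = \<phi> y \<longleftrightarrow> x = y"
    if "x \<in> set xs" "y \<in> set xs" for x y
  proof -
    have "x \<in> verts G" "y \<in> verts G" using that assms(2) by auto
    then show "{\<phi> x, \<phi> y} \<in> edges H \<longleftrightarrow> {x, y} \<in> edges G" "\<phi> x = \<phi> y \<longleftrightarrow> x = y"
      using assms(1) inj_on_eq_iff[OF inj] by (auto simp: iso_map_def)
  qed
  show ?thesis
    using im assms(2) by (auto simp: clique_def d e)
qed

lemma pull_in_cochains:
  assumes "iso_map \<phi> G H" "f \<in> cochains H n"
  shows "pull \<phi> G f \<in> cochains G n"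
proof -
  have "alternating (pull \<phi> G f)"
  proof (rule alternatingI)
    fix as a b bs
    show "pull \<phi> G f (as @ a # b # bs) = - pull \<phi> G f (as @ b # a # bs)"
      using assms(2) alternatingD[of f "map \<phi> as" "\<phi> a" "\<phi> b" "map \<phi> bs"]
      by (auto simp: pull_def cochains_def)
  qed
  then show ?thesis
    using assms(2) clique_map[OF assms(1)] by (auto simp: pull_def cochains_def split: if_splits)
qed

lemma face_sum_map: "face_sum (\<lambda>ys. f (map \<phi> ys)) xs = face_sum f (map \<phi> xs)"
  by (induction xs arbitrary: f) auto

lemma cobd_pull:
  assumes "iso_map \<phi> G H"
  shows "cobd G (pull \<phi> G f) = pull \<phi> G (cobd H f)"
proof
  fix xs
  show "cobd G (pull \<phi> G f) xs = pull \<phi> G (cobd H f) xs"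
  proof (cases "set xs \<subseteq> verts G")
    case True
    then have "face_sum (pull \<phi> G f) xs = face_sum (\<lambda>ys. f (map \<phi> ys)) xs"
      by (intro face_sum_cong) (auto simp: pull_def)
    then show ?thesis
      using True clique_map[OF assms True] by (simp add: cobd_def pull_def face_sum_map)
  next
    case False
    then show ?thesis by (auto simp: cobd_def pull_def clique_def)
  qed
qed

lemma pull_in_cocycles:
  "iso_map \<phi> G H \<Longrightarrow> f \<in> cocycles H k \<Longrightarrow> pull \<phi> G f \<in> cocycles G k"
  by (auto simp: cocycles_iff pull_in_cochains cobd_pull) (auto simp: pull_def)

lemma pull_in_coboundaries:
  "iso_map \<phi> G H \<Longrightarrow> f \<in> coboundaries H k \<Longrightarrow> pull \<phi> G f \<in> coboundaries G k"
  by (cases k) (auto simp: coboundaries_0 coboundaries_Suc cobd_pull[symmetric] pull_in_cochains,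
    auto simp: pull_def)

lemma pull_pull_inv:
  assumes "iso_map \<phi> G H" "f \<in> cochains G n"
  shows "pull \<phi> G (pull (inv_into (verts G) \<phi>) H f) = f"
proof
  fix xs
  have b: "bij_betw \<phi> (verts G) (verts H)" using assms by (simp add: iso_map_def)
  show "pull \<phi> G (pull (inv_into (verts G) \<phi>) H f) xs = f xs"
  proof (cases "set xs \<subseteq> verts G")
    case True
    then have "map (inv_into (verts G) \<phi> \<circ> \<phi>) xs = xs"
      using b by (intro map_idI) (auto simp: bij_betw_inv_into_left)
    moreover have "\<phi> ` set xs \<subseteq> verts H" using True b by (auto simp: bij_betw_def)
    ultimately show ?thesis using True by (simp add: pull_def)
  next
    case False
    then have "f xs = 0" using assms(2) by (auto simp: cochains_def clique_def)
    then show ?thesis using False by (simp add: pull_def)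
  qed
qed

lemma cohomology_isomorphic_iso_map:
  assumes "iso_map \<phi> G H"
  shows "cohomology_isomorphic k H G"
proof (rule cohomology_isomorphicI[of "pull \<phi> G"])
  let ?I = "inv_into (verts G) \<phi>"
  have I: "iso_map ?I H G" using assms by (rule iso_map_inv)
  show "pull \<phi> G ` cocycles H k = cocycles G k"
  proof (intro equalityI subsetI)
    fix f assume f: "f \<in> cocycles G k"
    then have "f = pull \<phi> G (pull ?I H f)"
      using pull_pull_inv[OF assms, of f "Suc k"] by (simp add: cocycles_iff)
    moreover have "pull ?I H f \<in> cocycles H k"
      using I f by (rule pull_in_cocycles)
    ultimately show "f \<in> pull \<phi> G ` cocycles H k" by (rule image_eqI)
  qed (auto simp: pull_in_cocycles[OF assms])
  fix f assume f: "f \<in> cocycles H k"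
  \<comment> \<open>The double inverse agrees with \<open>\<phi>\<close> only on
    \<open>verts G\<close>, which suffices because of the cutoff in \<open>pull\<close>.\<close>
  have "inv_into (verts H) ?I x = \<phi> x" if "x \<in> verts G" for x
    using assms that by (simp add: iso_map_def inv_into_inv_into_eq)
  then have "pull (inv_into (verts H) ?I) G f = pull \<phi> G f"
    by (auto simp: pull_def fun_eq_iff subset_iff intro!: arg_cong[of _ _ f])
  then have "pull ?I H (pull \<phi> G f) = f"
    using pull_pull_inv[OF I, of f "Suc k"] f by (simp add: cocycles_iff)
  then show "pull \<phi> G f \<in> coboundaries G k \<longleftrightarrow> f \<in> coboundaries H k"
    using pull_in_coboundaries[OF I, of "pull \<phi> G f" k] pull_in_coboundaries[OF assms, of f k] by auto
qed (auto simp: pull_def)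

text \<open>Recovering an edge from its image takes injectivity on that edge, so edges have to
  consist of vertices. This containment is the invariant carried through the homotopy steps.\<close>

lemma graph_iso_imp_iso_map:
  assumes "graph_iso G H" and "edges G \<subseteq> Pow (verts G)"
  shows "\<exists>\<phi>. iso_map \<phi> G H"
proof -
  obtain \<phi> where b: "bij_betw \<phi> (verts G) (verts H)" and e: "edges H = (\<lambda>e. \<phi> ` e) ` edges G"
    using assms(1) by (auto simp: graph_iso_def)
  have "{x, y} \<in> edges G" if xy: "x \<in> verts G" "y \<in> verts G" "{\<phi> x, \<phi> y} \<in> edges H" for x y
  proof -
    obtain d where d: "d \<in> edges G" "\<phi> ` {x, y} = \<phi> ` d" using xy(3) e by auto
    then have "{x, y} = d"
      using inj_on_image_eq_iff[of \<phi> "verts G" "{x, y}" d] b xy assms(2) by (auto simp: bij_betw_def)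
    then show ?thesis using d by simp
  qed
  moreover have "{\<phi> x, \<phi> y} \<in> edges H" if "{x, y} \<in> edges G" for x y
    using imageI[OF that, of "\<lambda>e. \<phi> ` e"] e by simp
  ultimately show ?thesis using b by (auto simp: iso_map_def)
qed

subsection \<open>Removing a vertex with acyclic unit sphere\<close>

text \<open>The source of the degree shift: deleting a leading \<open>z\<close> turns cliques of
  \<open>G\<close> into cliques of the unit sphere, with \<open>[z]\<close> going to
  \<open>[]\<close>.\<close>

lemma clique_Cons_unit_sphere:
  "clique G (z # xs) \<longleftrightarrow> z \<in> verts G \<and> clique (unit_sphere G z) xs"
proof -
  have "set xs \<subseteq> {y \<in> verts G. y \<noteq> z \<and> {z, y} \<in> edges G} \<longleftrightarrow>
      z \<notin> set xs \<and> set xs \<subseteq> verts G \<and> (\<forall>y\<in>set xs. {z, y} \<in> edges G)"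
    by auto
  moreover have "{y, z} = {z, y}" for y by blast
  ultimately show ?thesis
    unfolding clique_def unit_sphere_def induced_def by (auto; blast)
qed

lemma clique_remove_vertex: "clique (remove_vertex G z) xs \<longleftrightarrow> clique G xs \<and> z \<notin> set xs"
  by (auto simp: clique_def remove_vertex_def induced_def)

lemma not_in_clique_unit_sphere: "clique (unit_sphere G z) xs \<Longrightarrow> z \<notin> set xs"
  by (auto simp: clique_def unit_sphere_def induced_def)

text \<open>The alternating form supported on cliques containing \<open>z\<close> with
  \<open>h xs = insert_vertex z h (z # xs)\<close>, the inverse of deleting \<open>z\<close>.\<close>

fun insert_vertex :: "'a \<Rightarrow> ('a list \<Rightarrow> real) \<Rightarrow> 'a list \<Rightarrow> real" where
  "insert_vertex z h [] = 0"
| "insert_vertex z h (x # xs) = (if x = z then h xs else - insert_vertex z (\<lambda>ys. h (x # ys)) xs)"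

lemma insert_vertex_minus: "insert_vertex z (\<lambda>ys. - h ys) xs = - insert_vertex z h xs"
  by (induction xs arbitrary: h) auto

lemma insert_vertex_eq_0: "z \<notin> set xs \<Longrightarrow> insert_vertex z h xs = 0"
  by (induction xs arbitrary: h) auto

lemma insert_vertex_nonzero:
  "insert_vertex z h xs \<noteq> 0 \<Longrightarrow> \<exists>as bs. xs = as @ z # bs \<and> h (as @ bs) \<noteq> 0"
proof (induction xs arbitrary: h)
  case (Cons x xs)
  show ?case
  proof (cases "x = z")
    case True
    then show ?thesis using Cons.prems by (intro exI[of _ "[]"] exI[of _ xs]) simp
  next
    case False
    then obtain as bs where "xs = as @ z # bs" "h (x # as @ bs) \<noteq> 0"
      using Cons.IH[of "\<lambda>ys. h (x # ys)"] Cons.prems by auto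
    then show ?thesis by (intro exI[of _ "x # as"] exI[of _ bs]) simp
  qed
qed simp

lemma alternating_insert_vertex:
  assumes "alternating h" "\<And>ys. z \<in> set ys \<Longrightarrow> h ys = 0"
  shows "alternating (insert_vertex z h)"
proof (rule alternatingI)
  fix as a b bs
  show "insert_vertex z h (as @ a # b # bs) = - insert_vertex z h (as @ b # a # bs)"
    using assms
  proof (induction as arbitrary: h)
    case Nil
    have "(\<lambda>ys. h (a # b # ys)) = (\<lambda>ys. - h (b # a # ys))"
      using alternatingD[OF Nil(1), of "[]" a b] by (metis append_Nil)
    then have "insert_vertex z (\<lambda>ys. h (a # b # ys)) bs = - insert_vertex z (\<lambda>ys. h (b # a # ys)) bs"
      by (simp add: insert_vertex_minus)
    \<comment> \<open>The critical case is \<open>a = b = z\<close>, where antisymmetry demands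
      \<open>h (z # bs) = 0\<close>.\<close>
    then show ?case using Nil(2)[of "z # bs"] by auto
  next
    case (Cons x as)
    have "insert_vertex z (\<lambda>ys. h (x # ys)) (as @ a # b # bs) =
        - insert_vertex z (\<lambda>ys. h (x # ys)) (as @ b # a # bs)"
      by (rule Cons.IH[OF alternating_Cons[OF Cons.prems(1)]]) (simp add: Cons.prems(2))
    then show ?case
      using alternatingD[OF Cons.prems(1), of as a b bs] by simp
  qed
qed

lemma insert_vertex_in_cochains:
  assumes "z \<in> verts G" and h: "h \<in> cochains (unit_sphere G z) n"
  shows "insert_vertex z h \<in> cochains G (Suc n)"
proof -
  have "h ys = 0" if "z \<in> set ys" for ys
    using h that not_in_clique_unit_sphere[of G z ys] by (auto simp: cochains_def)
  then have "alternating (insert_vertex z h)"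
    using h by (intro alternating_insert_vertex) (auto simp: cochains_def)
  moreover have "clique G xs \<and> length xs = Suc n" if nz: "insert_vertex z h xs \<noteq> 0" for xs
  proof -
    obtain as bs where xs: "xs = as @ z # bs" and "h (as @ bs) \<noteq> 0"
      using insert_vertex_nonzero[OF nz] by blast
    then have "clique (unit_sphere G z) (as @ bs)" "length (as @ bs) = n"
      using h by (auto simp: cochains_def)
    moreover have "clique G xs \<longleftrightarrow> clique G (z # as @ bs)"
      unfolding xs by (rule clique_cong) simp
    ultimately show ?thesis
      using assms(1) xs by (simp add: clique_Cons_unit_sphere)
  qed
  ultimately show ?thesis by (simp add: cochains_def)
qed

text \<open>The list \<open>[]\<close> counts as a clique, so this is exactness of the augmented complex.\<close>

definition acyclic_graph :: "'a graph \<Rightarrow> bool" where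
  "acyclic_graph G \<longleftrightarrow> verts G \<noteq> {} \<and>
     (\<forall>n. \<forall>f\<in>cochains G (Suc n). cobd G f = (\<lambda>_. 0) \<longrightarrow> f \<in> cobd G ` cochains G n)"

text \<open>Moving \<open>z\<close> to the front costs only a sign, so a cochain is determined by
  its values away from \<open>z\<close> and on cliques that begin with \<open>z\<close>.\<close>

lemma cochains_eqI:
  assumes "f \<in> cochains G n" "g \<in> cochains G n"
    and off: "\<And>xs. z \<notin> set xs \<Longrightarrow> f xs = g xs"
    and on: "\<And>xs. clique G (z # xs) \<Longrightarrow> f (z # xs) = g (z # xs)"
  shows "f = g"
proof
  fix xs
  show "f xs = g xs"
  proof (cases "z \<in> set xs")
    case True
    then obtain as bs where xs: "xs = as @ z # bs" by (meson split_list)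
    have "f (z # as @ bs) = g (z # as @ bs)"
    proof (cases "clique G (z # as @ bs)")
      case False
      then have "f (z # as @ bs) = 0" "g (z # as @ bs) = 0"
        using assms(1,2) by (auto simp: cochains_def)
      then show ?thesis by simp
    qed (rule on)
    then show ?thesis
      using assms(1,2) alternating_move[of f as z bs] alternating_move[of g as z bs]
      by (simp add: xs cochains_def)
  qed (rule off)
qed

text \<open>In the expansion of \<open>face_sum f (z # xs)\<close> the face without \<open>z\<close>
  contributes 0, so the coboundary in the sphere is minus the one in \<open>G\<close>.\<close>

lemma link_closed:
  assumes f: "f \<in> cochains G (Suc n)" and z: "z \<in> verts G"
    and off: "\<And>xs. z \<notin> set xs \<Longrightarrow> f xs = 0" and closed: "cobd G f = (\<lambda>_. 0)"
  shows "(\<lambda>ys. f (z # ys)) \<in> cochains (unit_sphere G z) n"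
    and "cobd (unit_sphere G z) (\<lambda>ys. f (z # ys)) = (\<lambda>_. 0)"
proof -
  have "alternating (\<lambda>ys. f (z # ys))"
    using f by (intro alternating_Cons) (simp add: cochains_def)
  moreover have "clique (unit_sphere G z) xs \<and> length xs = n" if "f (z # xs) \<noteq> 0" for xs
    using f that by (auto simp: cochains_def clique_Cons_unit_sphere)
  ultimately show "(\<lambda>ys. f (z # ys)) \<in> cochains (unit_sphere G z) n"
    by (simp add: cochains_def)
  show "cobd (unit_sphere G z) (\<lambda>ys. f (z # ys)) = (\<lambda>_. 0)"
  proof
    fix xs
    show "cobd (unit_sphere G z) (\<lambda>ys. f (z # ys)) xs = 0"
    proof (cases "clique (unit_sphere G z) xs")
      case True
      then have "face_sum f (z # xs) = 0"
        using fun_cong[OF closed, of "z # xs"] z by (simp add: cobd_def clique_Cons_unit_sphere)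
      moreover have "f xs = 0"
        using True by (intro off not_in_clique_unit_sphere)
      ultimately show ?thesis by (simp add: cobd_def)
    qed (simp add: cobd_def)
  qed
qed

text \<open>A primitive on the sphere is carried back by \<open>insert_vertex\<close>. For
  \<open>n = 0\<close> it is a single number on \<open>[]\<close>, which becomes a function
  concentrated at \<open>z\<close>.\<close>

lemma relative_exact:
  assumes "acyclic_graph (unit_sphere G z)" and z: "z \<in> verts G"
    and f: "f \<in> cochains G (Suc (Suc n))"
    and off: "\<And>xs. z \<notin> set xs \<Longrightarrow> f xs = 0" and closed: "cobd G f = (\<lambda>_. 0)"
  shows "\<exists>g\<in>cochains G (Suc n). (\<forall>xs. z \<notin> set xs \<longrightarrow> g xs = 0) \<and> f = cobd G g"
proof -
  let ?S = "unit_sphere G z"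
  obtain h where h: "h \<in> cochains ?S n" and fh: "(\<lambda>ys. f (z # ys)) = cobd ?S h"
    using assms(1) link_closed[OF f z off closed] unfolding acyclic_graph_def by blast
  \<comment> \<open>The factor -1 cancels the sign produced by splitting \<open>z\<close> off in
    \<open>face_sum\<close>.\<close>
  define g where "g = (\<lambda>xs. -1 * insert_vertex z h xs)"
  have g: "g \<in> cochains G (Suc n)"
    unfolding g_def by (intro cochains_scale insert_vertex_in_cochains z h)
  have goff: "g xs = 0" if "z \<notin> set xs" for xs
    using that by (simp add: g_def insert_vertex_eq_0)
  have "f = cobd G g"
  proof (rule cochains_eqI[OF f cobd_in_cochains[OF g]])
    fix xs assume xs: "z \<notin> set xs"
    then have "face_sum g xs = face_sum (\<lambda>_. 0) xs"
      by (intro face_sum_cong) (auto intro: goff)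
    then show "f xs = cobd G g xs"
      using off[OF xs] by (simp add: cobd_def)
  next
    fix xs assume c: "clique G (z # xs)"
    then have "clique ?S xs" by (simp add: clique_Cons_unit_sphere)
    then have "g xs = 0"
      by (intro goff not_in_clique_unit_sphere)
    then have "cobd G g (z # xs) = - face_sum (\<lambda>ys. g (z # ys)) xs"
      using c by (simp add: cobd_def)
    also have "\<dots> = face_sum h xs"
      by (simp add: g_def face_sum_minus)
    also have "\<dots> = f (z # xs)"
      using fun_cong[OF fh, of xs] \<open>clique ?S xs\<close> by (simp add: cobd_def)
    finally show "f (z # xs) = cobd G g (z # xs)" by simp
  qed
  then show ?thesis using g goff by blast
qed

text \<open>Such an \<open>f\<close> is determined by \<open>f [z]\<close>, and closedness on an
  edge from \<open>z\<close> to a point \<open>y\<close> of the sphere forces this number to be 0.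
  This is where the sphere has to be nonempty.\<close>

lemma relative_zero:
  assumes "acyclic_graph (unit_sphere G z)" and z: "z \<in> verts G"
    and f: "f \<in> cochains G (Suc 0)"
    and off: "\<And>xs. z \<notin> set xs \<Longrightarrow> f xs = 0" and closed: "cobd G f = (\<lambda>_. 0)"
  shows "f = (\<lambda>_. 0)"
proof (rule cochains_eqI[OF f cochains_zero])
  obtain y where y: "y \<in> verts (unit_sphere G z)"
    using assms(1) by (auto simp: acyclic_graph_def)
  then have "clique (unit_sphere G z) [y]"
    by (auto simp: clique_def)
  then have "f [z] = 0"
    using fun_cong[OF link_closed(2)[OF f z off closed], of "[y]"] by (simp add: cobd_def)
  then show "f (z # xs) = 0" for xs
    using f by (cases xs) (auto simp: cochains_def)
qed (rule off)

section \<open>Restriction of forms to the graph without \<open>z\<close>\<close>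

definition restrict_form :: "'a \<Rightarrow> ('a list \<Rightarrow> real) \<Rightarrow> 'a list \<Rightarrow> real" where
  "restrict_form z f xs = (if z \<in> set xs then 0 else f xs)"

lemma restrict_in_cochains:
  assumes "f \<in> cochains G n"
  shows "restrict_form z f \<in> cochains (remove_vertex G z) n"
proof -
  have "alternating (restrict_form z f)"
  proof (rule alternatingI)
    fix as a b bs
    show "restrict_form z f (as @ a # b # bs) = - restrict_form z f (as @ b # a # bs)"
      using assms alternatingD[of f as a b bs] by (simp add: restrict_form_def cochains_def)
  qed
  then show ?thesis
    using assms by (auto simp: restrict_form_def cochains_def clique_remove_vertex split: if_splits)
qed

text \<open>Forms vanish off cliques, so extension by zero is the identity; with
  \<open>restrict_form_id\<close> this makes restriction surjective.\<close>

lemma cochains_remove_vertex: "f \<in> cochains (remove_vertex G z) n \<Longrightarrow> f \<in> cochains G n"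
  by (auto simp: cochains_def clique_remove_vertex)

lemma restrict_form_id: "f \<in> cochains (remove_vertex G z) n \<Longrightarrow> restrict_form z f = f"
  by (auto simp: restrict_form_def cochains_def clique_remove_vertex fun_eq_iff)

lemma cobd_restrict_form:
  "cobd (remove_vertex G z) (restrict_form z f) = restrict_form z (cobd G f)"
proof
  fix xs
  have "face_sum (restrict_form z f) xs = face_sum f xs" if "z \<notin> set xs"
    using that by (intro face_sum_cong) (auto simp: restrict_form_def)
  then show "cobd (remove_vertex G z) (restrict_form z f) xs = restrict_form z (cobd G f) xs"
    by (simp add: cobd_def clique_remove_vertex restrict_form_def)
qed

lemma restrict_form_eq_0D: "restrict_form z f = (\<lambda>_. 0) \<Longrightarrow> z \<notin> set xs \<Longrightarrow> f xs = 0"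
  by (metis restrict_form_def)

lemma cohomology_remove_vertex:
  assumes ac: "acyclic_graph (unit_sphere G z)" and z: "z \<in> verts G"
  shows "cohomology_isomorphic k G (remove_vertex G z)"
proof (rule cohomology_isomorphicI[of "restrict_form z"])
  let ?R = "remove_vertex G z"
  show "restrict_form z ` cocycles G k = cocycles ?R k"
  proof (intro equalityI subsetI)
    fix f assume "f \<in> restrict_form z ` cocycles G k"
    then show "f \<in> cocycles ?R k"
      by (auto simp: cocycles_iff restrict_in_cochains cobd_restrict_form)
        (auto simp: restrict_form_def)
  next
    fix f assume f: "f \<in> cocycles ?R k"
    then have fR: "f \<in> cochains ?R (Suc k)" by (simp add: cocycles_iff)
    then have fG: "f \<in> cochains G (Suc k)" by (rule cochains_remove_vertex)
    have off: "restrict_form z (cobd G f) = (\<lambda>_. 0)"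
      using f restrict_form_id[OF fR] cobd_restrict_form[of G z f] by (simp add: cocycles_iff)
    \<comment> \<open>The extension of \<open>f\<close> by zero need not be closed on
      \<open>G\<close>, but its coboundary restricts to 0 and so has a primitive \<open>g\<close> in
      the kernel. Then \<open>f - g\<close> is closed and still restricts to
      \<open>f\<close>.\<close>
    obtain g where g: "g \<in> cochains G (Suc k)" "\<And>xs. z \<notin> set xs \<Longrightarrow> g xs = 0"
      "cobd G f = cobd G g"
      using relative_exact[OF ac z cobd_in_cochains[OF fG] restrict_form_eq_0D[OF off] cobd_cobd] by blast
    have "(\<lambda>xs. f xs - g xs) \<in> cocycles G k"
      using fG g by (simp add: cocycles_iff cochains_diff cobd_diff)
    moreover have "restrict_form z f = restrict_form z (\<lambda>xs. f xs - g xs)"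
      using g(2) by (simp add: restrict_form_def fun_eq_iff)
    then have "f = restrict_form z (\<lambda>xs. f xs - g xs)"
      by (simp add: restrict_form_id[OF fR])
    ultimately show "f \<in> restrict_form z ` cocycles G k" 
      by (rule rev_image_eqI[where x = "\<lambda>xs. f xs - g xs"])
  qed
  fix f assume f: "f \<in> cocycles G k"
  show "restrict_form z f \<in> coboundaries ?R k \<longleftrightarrow> f \<in> coboundaries G k"
  proof (cases k)
    case 0
    have "f = (\<lambda>_. 0)" if "restrict_form z f = (\<lambda>_. 0)"
      using relative_zero[OF ac z _ restrict_form_eq_0D[OF that]] f by (simp add: cocycles_iff 0)
    then show ?thesis by (auto simp: 0 coboundaries_0 restrict_form_def)
  next
    case (Suc m)
    show ?thesis
    proof
      assume "f \<in> coboundaries G k"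
      then show "restrict_form z f \<in> coboundaries ?R k"
        by (auto simp: Suc coboundaries_Suc cobd_restrict_form[symmetric] restrict_in_cochains)
    next
      assume "restrict_form z f \<in> coboundaries ?R k"
      then obtain h where h: "h \<in> cochains ?R (Suc m)" "restrict_form z f = cobd ?R h"
        by (auto simp: Suc coboundaries_Suc)
      have hG: "h \<in> cochains G (Suc m)" using h(1) by (rule cochains_remove_vertex)
      \<comment> \<open>Subtracting the coboundary of the extended primitive \<open>h\<close> leaves
        a closed form in the kernel of restriction, hence an exact one.\<close>
      let ?d = "\<lambda>xs. f xs - cobd G h xs"
      have "restrict_form z f = restrict_form z (cobd G h)"
        using h restrict_form_id[OF h(1)] cobd_restrict_form[of G z h] by simp
      then have "?d xs = 0" if "z \<notin> set xs" for xs
        using that by (metis diff_self restrict_form_def)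
      moreover have "?d \<in> cochains G (Suc (Suc m))"
        using f hG by (intro cochains_diff cobd_in_cochains) (simp_all add: cocycles_iff Suc)
      moreover have "cobd G ?d = (\<lambda>_. 0)"
        using f by (simp add: cobd_diff cobd_cobd cocycles_iff)
      ultimately obtain g where "g \<in> cochains G (Suc m)" "?d = cobd G g"
        using relative_exact[OF ac z, of ?d m] by blast
      then have "?d \<in> coboundaries G k" "cobd G h \<in> coboundaries G k"
        using hG by (auto simp: Suc coboundaries_Suc)
      from coboundaries_add[OF this] show "f \<in> coboundaries G k" by simp
    qed
  qed
qed (auto simp: restrict_form_def)

subsection \<open>Cohomology of a point\<close>

lemma cochains_one_eqI:
  assumes "f \<in> cochains G (Suc 0)" "g \<in> cochains G (Suc 0)"
    and "\<And>x. x \<in> verts G \<Longrightarrow> f [x] = g [x]"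
  shows "f = g"
proof
  fix xs
  show "f xs = g xs"
  proof (cases "\<exists>x\<in>verts G. xs = [x]")
    case False
    then have "\<not> (clique G xs \<and> length xs = Suc 0)"
      by (auto simp: clique_def length_Suc_conv)
    then have "f xs = 0" "g xs = 0" using assms(1,2) by (auto simp: cochains_def)
    then show ?thesis by simp
  qed (use assms(3) in auto)
qed

lemma const_form_in_cochains:
  "(\<lambda>xs. if xs = [] then c else 0) \<in> cochains G 0"
  by (auto simp: cochains_def clique_def intro!: alternatingI)

lemma cobd_const_form:
  "x \<in> verts G \<Longrightarrow> cobd G (\<lambda>xs. if xs = [] then c else 0) [x] = c"
  by (simp add: cobd_def clique_def)

text \<open>The image of the augmentation: value \<open>c\<close> at each vertex. Written as a
  coboundary, it is closed by \<open>cobd_cobd\<close> and has the shape required by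
  \<open>acyclic_graph\<close> at \<open>n = 0\<close>.\<close>

abbreviation constants :: "'a graph \<Rightarrow> real \<Rightarrow> 'a list \<Rightarrow> real" where
  "constants G c \<equiv> cobd G (\<lambda>xs. if xs = [] then c else 0)"

lemma constants_in_cocycles: "constants G c \<in> cocycles G 0"
  by (simp add: cocycles_iff cobd_in_cochains const_form_in_cochains cobd_cobd)

lemma constants_scale: "(\<lambda>xs. a * constants G c xs) = constants G (a * c)"
  unfolding cobd_scale[symmetric] by (rule arg_cong[of _ _ "cobd G"]) auto

lemma cocycles_one_point_0:
  assumes "f \<in> cocycles (one_point v) 0"
  shows "f = constants (one_point v) (f [v])"
proof (rule cochains_one_eqI)
  show "f \<in> cochains (one_point v) (Suc 0)" using assms by (simp add: cocycles_iff)
  show "constants (one_point v) (f [v]) \<in> cochains (one_point v) (Suc 0)"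
    by (intro cobd_in_cochains const_form_in_cochains)
qed (auto simp: cobd_const_form one_point_def)

lemma cocycles_one_point_Suc:
  assumes "f \<in> cocycles (one_point v) (Suc m)"
  shows "f = (\<lambda>_. 0)"
proof
  fix xs
  have "length xs \<le> 1" if "clique (one_point v) xs"
  proof -
    have "card (set xs) \<le> card {v}"
      using that by (intro card_mono) (auto simp: clique_def one_point_def)
    then show ?thesis using that by (simp add: clique_def distinct_card)
  qed
  then show "f xs = 0" using assms by (force simp: cocycles_iff cochains_def)
qed

text \<open>In degree 0 bijectivity and homogeneity of \<open>F\<close> suffice: the class of the
  constant 1 goes to a nonzero \<open>t\<close>, so a class with value \<open>s\<close> is that of
  the constant \<open>s / t\<close>. In higher degrees a bijection onto a single class is
  enough.\<close>

lemma acyclic_graphI: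
  assumes iso: "\<And>k. cohomology_isomorphic k G (one_point v)"
  shows "acyclic_graph G"
proof -
  let ?P = "one_point v"
  have inj: "(\<lambda>xs. f xs - g xs) \<in> coboundaries G k"
    if "bij_betw F (cohomology G k) (cohomology ?P k)" "f \<in> cocycles G k" "g \<in> cocycles G k"
      "F (hclass G k f) = F (hclass G k g)" for F k f g
  proof -
    have "hclass G k f = hclass G k g"
      using that by (auto simp: bij_betw_def cohomology_eq dest: inj_onD)
    then show ?thesis using that by (simp add: hclass_eq_iff)
  qed
  obtain F where F: "bij_betw F (cohomology G 0) (cohomology ?P 0)"
    and scale: "\<And>c X. X \<in> cohomology G 0 \<Longrightarrow> F (class_scale G 0 c X) = class_scale ?P 0 c (F X)"
    using iso[of 0] unfolding cohomology_isomorphic_def by blast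
  have Fvalue: "\<exists>s. F (hclass G 0 f) = hclass ?P 0 (constants ?P s)" if f: "f \<in> cocycles G 0" for f
  proof -
    have "F (hclass G 0 f) \<in> cohomology ?P 0"
      using f by (intro bij_betw_apply[OF F]) (simp add: cohomology_eq)
    then obtain g where "g \<in> cocycles ?P 0" "F (hclass G 0 f) = hclass ?P 0 g"
      by (auto simp: cohomology_eq)
    then show ?thesis using cocycles_one_point_0[of g v] by metis
  qed
  have Fscale: "F (hclass G 0 (constants G (a * c))) = hclass ?P 0 (constants ?P (a * s))"
    if "F (hclass G 0 (constants G c)) = hclass ?P 0 (constants ?P s)" for a c s
  proof -
    have "F (class_scale G 0 a (hclass G 0 (constants G c))) =
        class_scale ?P 0 a (hclass ?P 0 (constants ?P s))"
      using scale[of "hclass G 0 (constants G c)" a] that constants_in_cocycles[of G c]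
      by (simp add: cohomology_eq)
    then show ?thesis
      by (simp add: class_scale_hclass constants_in_cocycles constants_scale)
  qed
  \<comment> \<open>Without vertices there is only one class in degree 0, while the constants 0 and
    1 on the point give two.\<close>
  have ne: "verts G \<noteq> {}"
  proof
    assume empty: "verts G = {}"
    have zero: "f = (\<lambda>_. 0)" if "f \<in> cocycles G 0" for f
      using that empty by (intro cochains_one_eqI) (auto simp: cocycles_iff)
    have same: "hclass ?P 0 (constants ?P s) = F (hclass G 0 (\<lambda>_. 0))" for s
    proof -
      have "hclass ?P 0 (constants ?P s) \<in> F ` cohomology G 0"
        using F constants_in_cocycles[of ?P s] by (simp add: bij_betw_def cohomology_eq)
      then show ?thesis using zero by (auto simp: cohomology_eq)
    qed
    have "hclass ?P 0 (constants ?P 1) = hclass ?P 0 (constants ?P 0)"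
      by (rule trans[OF same same[symmetric]])
    then have "(\<lambda>xs. constants ?P 1 xs - constants ?P 0 xs) = (\<lambda>_. 0)"
      by (simp add: hclass_eq_iff constants_in_cocycles coboundaries_0)
    from fun_cong[OF this, of "[v]"] show False
      by (simp add: cobd_const_form one_point_def)
  qed
  then obtain x where x: "x \<in> verts G" by blast
  obtain t where t: "F (hclass G 0 (constants G 1)) = hclass ?P 0 (constants ?P t)"
    using Fvalue[OF constants_in_cocycles] by blast
  \<comment> \<open>Otherwise injectivity of \<open>F\<close> would identify the constants 1 and 0
    on \<open>G\<close>, which differ at \<open>x\<close>; degree 0 has no nonzero
    coboundaries.\<close>
  have "t \<noteq> 0"
  proof
    assume "t = 0"
    have "F (hclass G 0 (constants G 0)) = hclass ?P 0 (constants ?P t)"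
      using Fscale[OF t, of 0] unfolding \<open>t = 0\<close> mult_zero_left .
    then have "F (hclass G 0 (constants G 1)) = F (hclass G 0 (constants G 0))"
      by (rule trans[OF t sym])
    then have "(\<lambda>xs. constants G 1 xs - constants G 0 xs) \<in> coboundaries G 0"
      by (rule inj[OF F constants_in_cocycles constants_in_cocycles])
    then have "(\<lambda>xs. constants G 1 xs - constants G 0 xs) = (\<lambda>_. 0)"
      unfolding coboundaries_0 by (rule singletonD)
    from fun_cong[OF this, of "[x]"] show False
      using x by (simp add: cobd_const_form)
  qed
  have "f \<in> cobd G ` cochains G n" if f: "f \<in> cochains G (Suc n)" "cobd G f = (\<lambda>_. 0)" for n f
  proof (cases n)
    case 0
    have f0: "f \<in> cocycles G 0" using f 0 by (simp add: cocycles_iff)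
    then obtain s where "F (hclass G 0 f) = hclass ?P 0 (constants ?P s)"
      using Fvalue by blast
    also have "\<dots> = F (hclass G 0 (constants G (s / t)))"
    proof -
      have "s / t * t = s" using \<open>t \<noteq> 0\<close> by simp
      then show ?thesis
        using Fscale[OF t, of "s / t"] by (simp only: mult_1_right)
    qed
    finally have "(\<lambda>xs. f xs - constants G (s / t) xs) = (\<lambda>_. 0)"
      using inj[OF F f0 constants_in_cocycles] by (simp add: coboundaries_0)
    then have "f = constants G (s / t)" by (simp add: fun_eq_iff)
    then show ?thesis using 0 const_form_in_cochains by blast
  next
    case (Suc m)
    obtain F' where F': "bij_betw F' (cohomology G n) (cohomology ?P n)"
      using iso[of n] unfolding cohomology_isomorphic_def by blast
    have fn: "f \<in> cocycles G n" using f by (simp add: cocycles_iff)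
    have "F' (hclass G n g) = hclass ?P n (\<lambda>_. 0)" if "g \<in> cocycles G n" for g
    proof -
      have "F' (hclass G n g) \<in> cohomology ?P n"
        using that by (intro bij_betw_apply[OF F']) (simp add: cohomology_eq)
      then show ?thesis using cocycles_one_point_Suc[of _ v m] by (auto simp: cohomology_eq Suc)
    qed
    then have "F' (hclass G n f) = F' (hclass G n (\<lambda>_. 0))"
      using fn by simp
    from inj[OF F' fn cocycles_zero this] show ?thesis
      by (simp add: Suc coboundaries_Suc)
  qed
  then show ?thesis using ne by (auto simp: acyclic_graph_def)
qed

subsection \<open>Homotopy and homeomorphism\<close>

text \<open>With \<open>unit_sphere_add_vertex\<close>, this presents an extension as a reversed
  reduction, so \<open>cohomology_remove_vertex\<close> handles both steps.\<close>

lemma remove_vertex_add_vertex: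
  assumes "edges G \<subseteq> Pow (verts G)" "z \<notin> verts G"
  shows "remove_vertex (add_vertex G S z) z = G"
  using assms by (cases G) (auto simp: remove_vertex_def add_vertex_def induced_def)

lemma unit_sphere_add_vertex:
  assumes "edges G \<subseteq> Pow (verts G)" "z \<notin> verts G" "S \<subseteq> verts G"
  shows "unit_sphere (add_vertex G S z) z = induced G S"
proof -
  have "{y \<in> verts (add_vertex G S z). y \<noteq> z \<and> {z, y} \<in> edges (add_vertex G S z)} = S"
    using assms by (auto simp: add_vertex_def doubleton_eq_iff)
  moreover have "{e \<in> edges (add_vertex G S z). e \<subseteq> S} = {e \<in> edges G. e \<subseteq> S}"
    using assms by (auto simp: add_vertex_def)
  ultimately show ?thesis by (simp add: unit_sphere_def induced_def)
qed

text \<open>In the extension and reduction cases the rule has a second recursive premise,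
  contractibility of the attached subgraph or sphere. Its induction hypothesis compares that graph
  with a point in every degree, which is the input of \<open>acyclic_graphI\<close>.\<close>

lemma nat_homotopic_cohomology:
  assumes "nat_homotopic G H"
  shows "edges G \<subseteq> Pow (verts G) \<and> edges H \<subseteq> Pow (verts H) \<and> (\<forall>k. cohomology_isomorphic k G H)"
  using assms
proof (induction rule: nat_homotopic.induct)
  case (start G)
  then show ?case by (auto simp: simple_graph_def cohomology_isomorphic_refl)
next
  case (rename G H K)
  have e: "edges H \<subseteq> Pow (verts H)" using rename.IH by simp
  obtain \<phi> where "iso_map \<phi> H K"
    using graph_iso_imp_iso_map[OF rename.hyps(2) e] ..
  then have step: "cohomology_isomorphic k H K" for k
    by (rule cohomology_isomorphic_sym[OF cohomology_isomorphic_iso_map])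
  have "cohomology_isomorphic k G K" for k
    by (rule cohomology_isomorphic_trans[OF _ step]) (simp add: rename.IH)
  moreover have "edges K \<subseteq> Pow (verts K)"
  proof -
    obtain f where "f ` verts H = verts K" "edges K = (\<lambda>e. f ` e) ` edges H"
      using rename.hyps(2) by (auto simp: graph_iso_def bij_betw_def)
    then show ?thesis
      using e by (metis (no_types, lifting) PowD PowI image_mono image_subsetI subsetD)
  qed
  ultimately show ?case
    using rename.IH by simp
next
  case (extension G H S z)
  let ?K = "add_vertex H S z"
  have "acyclic_graph (unit_sphere ?K z)"
    using extension acyclic_graphI[of "induced H S" "0::nat"] by (simp add: unit_sphere_add_vertex)
  then have "cohomology_isomorphic k ?K (remove_vertex ?K z)" for k
    by (rule cohomology_remove_vertex) (simp add: add_vertex_def)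
  moreover have "remove_vertex ?K z = H"
    using extension by (simp add: remove_vertex_add_vertex)
  ultimately have step: "cohomology_isomorphic k H ?K" for k
    by (simp add: cohomology_isomorphic_sym)
  have "cohomology_isomorphic k G ?K" for k
    by (rule cohomology_isomorphic_trans[OF _ step]) (simp add: extension.IH)
  moreover have "edges ?K \<subseteq> Pow (verts ?K)"
    using extension.IH(1) extension.hyps(2) by (auto simp: add_vertex_def)
  ultimately show ?case
    using extension.IH by simp
next
  case (reduction G H z)
  have "acyclic_graph (unit_sphere H z)"
    using reduction.IH acyclic_graphI[of "unit_sphere H z" "0::nat"] by simp
  then have step: "cohomology_isomorphic k H (remove_vertex H z)" for k
    using reduction.hyps(2) by (rule cohomology_remove_vertex)
  have "cohomology_isomorphic k G (remove_vertex H z)" for k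
    by (rule cohomology_isomorphic_trans[OF _ step]) (simp add: reduction.IH)
  moreover have "edges (remove_vertex H z) \<subseteq> Pow (verts (remove_vertex H z))"
    by (auto simp: remove_vertex_def induced_def)
  ultimately show ?case
    using reduction.IH by simp
qed

lemma homotopic_graphs_cohomology:
  assumes "homotopic_graphs G H" "edges G \<subseteq> Pow (verts G)" "edges H \<subseteq> Pow (verts H)"
  shows "cohomology_isomorphic k G H"
proof -
  obtain G' H' where *: "graph_iso G G'" "graph_iso H H'" "nat_homotopic G' H'"
    using assms(1) by (auto simp: homotopic_graphs_def)
  obtain \<phi> where "iso_map \<phi> G G'" using graph_iso_imp_iso_map[OF *(1) assms(2)] ..
  then have "cohomology_isomorphic k G G'"
    by (rule cohomology_isomorphic_sym[OF cohomology_isomorphic_iso_map])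
  also have "cohomology_isomorphic k G' H'"
    using nat_homotopic_cohomology[OF *(3)] by blast
  also obtain \<psi> where "iso_map \<psi> H H'" using graph_iso_imp_iso_map[OF *(2) assms(3)] ..
  then have "cohomology_isomorphic k H' H"
    by (rule cohomology_isomorphic_iso_map)
  finally show ?thesis .
qed

lemma graph_homeomorphism_iso_map:
  assumes "graph_homeomorphism \<B> T \<C> P \<phi> \<psi>"
  shows "iso_map \<psi> (nerve \<B>) (nerve \<C>)"
proof -
  obtain \<phi>' \<psi>' where "graph_continuous \<B> T \<C> P \<phi> \<psi>" "graph_continuous \<C> P \<B> T \<phi>' \<psi>'"
    and "\<forall>A\<in>\<B>. \<psi>' (\<psi> A) = A" "\<forall>C\<in>\<C>. \<psi> (\<psi>' C) = C"
    using assms unfolding graph_homeomorphism_def by (elim conjE exE)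
  then have hom: "graph_hom \<psi> (nerve \<B>) (nerve \<C>)" and hom': "graph_hom \<psi>' (nerve \<C>) (nerve \<B>)"
    and inv: "\<And>A. A \<in> \<B> \<Longrightarrow> \<psi>' (\<psi> A) = A" "\<And>C. C \<in> \<C> \<Longrightarrow> \<psi> (\<psi>' C) = C"
    by (simp_all add: graph_continuous_def)
  have v: "verts (nerve \<B>) = \<B>" "verts (nerve \<C>) = \<C>"
    by (simp_all add: nerve_def)
  have "bij_betw \<psi> \<B> \<C>"
    using hom hom' inv by (intro bij_betw_byWitness[where f' = \<psi>']) (auto simp: graph_hom_def v)
  moreover have "{A, B} \<in> edges (nerve \<B>) \<longleftrightarrow> {\<psi> A, \<psi> B} \<in> edges (nerve \<C>)"
    if "A \<in> \<B>" "B \<in> \<B>" for A B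
  proof
    \<comment> \<open>A bijective homomorphism need not reflect edges; here the inverse is a
      homomorphism as well.\<close>
    assume "{\<psi> A, \<psi> B} \<in> edges (nerve \<C>)"
    then have "{\<psi>' (\<psi> A), \<psi>' (\<psi> B)} \<in> edges (nerve \<B>)"
      using hom' by (simp add: graph_hom_def)
    then show "{A, B} \<in> edges (nerve \<B>)" using inv(1) that by simp
  qed (use hom in \<open>simp add: graph_hom_def\<close>)
  ultimately show ?thesis by (simp add: iso_map_def v)
qed

theorem theorem4:
  fixes G :: "'a graph" and H :: "'b graph"
  assumes "simple_graph G" and "simple_graph H"
    and "homeomorphic_graphs G H"
  shows "\<forall>k. cohomology_isomorphic k G H"
proof
  fix k
  obtain \<B> T \<C> P \<phi> \<psi> where G: "topological_graph G \<B> T" and H: "topological_graph H \<C> P"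
    and \<psi>: "graph_homeomorphism \<B> T \<C> P \<phi> \<psi>"
    using assms(3) unfolding homeomorphic_graphs_def by blast
  \<comment> \<open>The type \<open>'c\<close> is left general so that the fact applies to the
    nerves over both vertex types.\<close>
  have nerve: "edges (nerve \<A>) \<subseteq> Pow (verts (nerve \<A>))" for \<A> :: "'c graph set"
    by (auto simp: nerve_def)
  have "cohomology_isomorphic k (nerve \<B>) G"
    using G by (intro homotopic_graphs_cohomology nerve) (auto simp: topological_graph_def simple_graph_def)
  then have "cohomology_isomorphic k G (nerve \<B>)"
    by (rule cohomology_isomorphic_sym)
  also have "cohomology_isomorphic k (nerve \<B>) (nerve \<C>)"
    using graph_homeomorphism_iso_map[OF \<psi>]
    by (rule cohomology_isomorphic_sym[OF cohomology_isomorphic_iso_map])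
  also have "cohomology_isomorphic k (nerve \<C>) H"
    using H by (intro homotopic_graphs_cohomology nerve) (auto simp: topological_graph_def simple_graph_def)
  finally show "cohomology_isomorphic k G H" .
qed

end
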